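(* Let $C$ be a clutter with finite vertex set $X$, let $\Bbbk$ be a field, and for $s\in\mathbb{N}$ let $\delta_s\colon \Bbbk[\mathcal{J}_s(X)]\to\Bbbk[X]$ be the depolarization map. For every $s\in\mathbb{N}$ we have $$\delta_s\bigl(I_c(\mathcal{J}_s(C))\bigr)=I_c(C)^{(s+1)}.$$ Moreover, $\delta_s$ induces a bijection between the set of minimal (monomial) generators of $I_c(\mathcal{J}_s(C))$ and the set of minimal (monomial) generators of $I_c(C)^{(s+1)}$.
   Context: $\mathbb{N}$ includes $0$. A clutter $C$ with vertex set $X$ is a family $E(C)$ of subsets of $X$ (edges), none of which is contained in another. For a field $\Bbbk$, $\Bbbk[X]$ is the polynomial ring with the elements of $X$ as variables; the edge ideal $I(C)\subseteq\Bbbk[X]$ is generated by the monomials $x_1\cdots x_r$ with $\{x_1,\dots,x_r\}\in E(C)$. This gives a bijection between clutters on $X$ and squarefree monomial ideals of $\Bbbk[X]$. For $s\in\mathbb{N}$ let $\mathcal{J}_s(X)=\bigcup_{x\in X}\{x_0,\dots,x_s\}$ (new distinct variables), and let $\phi_s\colon\Bbbk[X]\to\Bbbk[\mathcal{J}_s(X)][t]/\langle t^{s+1}\rangle$ be the $\Bbbk$-algebra homomorphism with $\phi_s(x)=\sum_{j=0}^s x_jt^j$. For an ideal $I=\langle f_1,\dots,f_r\rangle$ of $\Bbbk[X]$, the ideal of $s$-jets $\mathcal{J}_s(I)\subseteq\Bbbk[\mathcal{J}_s(X)]$ is generated by the $f_{i,j}$ ($1\le i\le r$, $0\le j\le s$)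 determined by $\phi_s(f_i)=\sum_{j=0}^s f_{i,j}t^j$. By a known theorem of Goward and Smith, if $I$ is a squarefree monomial ideal, then $\sqrt{\mathcal{J}_s(I)}$ is the squarefree monomial ideal minimally generated by the monomials $x_{1,i_1}\cdots x_{r,i_r}$ such that $x_1\cdots x_r$ is a minimal generator of $I$ and $i_1+\dots+i_r\le s$. The clutter of $s$-jets $\mathcal{J}_s(C)$ is the clutter with vertex set $\mathcal{J}_s(X)$ whose edge ideal is $\sqrt{\mathcal{J}_s(I(C))}$. A vertex cover of a clutter is a set of vertices meeting every edge; it is minimal if no proper subset is a vertex cover. The ideal of covers $I_c(C)$ is generated by the monomials $\prod_{w\in W}w$ for $W$ a minimal vertex cover of $C$; equivalently $I_c(C)=\bigcap_{\{x_1,\dots,x_r\}\in E(C)}\langle x_1,\dots,x_r\rangle$. Its $k$-th symbolic power is $I_c(C)^{(k)}=\bigcap_{\{x_1,\dots,x_r\}\in E(C)}\langle x_1,\dots,x_r\rangle^k$. The depolarization map $\delta_s\colon\Bbbk[\mathcal{J}_s(X)]\to\Bbbk[X]$ is the $\Bbbk$-algebra homomorphism with $\delta_s(x_i)=x$ for all $x\in X$, $0\le i\le s$. *)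

theory Defs
  imports
    "HOL-Library.Poly_Mapping"
    "HOL-Computational_Algebra.Polynomial"
    "HOL-Algebra.Ideal_Product"
begin

section \<open>Polynomial rings over an arbitrary set of variables\<close>

text \<open>
  A monomial is an exponent vector \<open>'x \<Rightarrow>\<^sub>0 nat\<close>, and a polynomial is a finitely supported map
  from monomials to coefficients, with the convolution product of \<^theory>\<open>HOL-Library.Poly_Mapping\<close>.
  The set \<open>X\<close> of variables is a carrier set inside the type \<open>'x\<close>, so \<open>\<k>[X]\<close> is the
  subring of the polynomials all of whose monomials involve variables of \<open>X\<close> only.
\<close>

type_synonym ('x, 'k) mpoly = "('x \<Rightarrow>\<^sub>0 nat) \<Rightarrow>\<^sub>0 'k"

definition mpoly_ring :: "'x set \<Rightarrow> ('x, 'k::comm_ring_1) mpoly ring" where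
  "mpoly_ring X =
     \<lparr>carrier = {p. \<forall>m \<in> Poly_Mapping.keys p. Poly_Mapping.keys m \<subseteq> X},
      mult = (*), one = 1, zero = 0, add = (+)\<rparr>"

lemma cring_mpoly_ring: "cring (mpoly_ring X :: ('x, 'k::comm_ring_1) mpoly ring)"
proof (rule cringI)
  let ?C = "{p :: ('x, 'k) mpoly. \<forall>m \<in> Poly_Mapping.keys p. Poly_Mapping.keys m \<subseteq> X}"
  have mult: "p * q \<in> ?C" if "p \<in> ?C" "q \<in> ?C" for p q
  proof (rule CollectI, rule ballI)
    fix m assume "m \<in> Poly_Mapping.keys (p * q)"
    from subsetD[OF Poly_Mapping.keys_mult this]
    obtain a b where m: "m = a + b" and "a \<in> Poly_Mapping.keys p" "b \<in> Poly_Mapping.keys q"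
      by (elim CollectE exE conjE)
    with that have "Poly_Mapping.keys a \<subseteq> X" "Poly_Mapping.keys b \<subseteq> X"
      by simp_all
    with Poly_Mapping.keys_add[of a b] show "Poly_Mapping.keys m \<subseteq> X"
      unfolding m by (meson Un_least order_trans)
  qed
  have add: "p + q \<in> ?C" if "p \<in> ?C" "q \<in> ?C" for p q
  proof (rule CollectI, rule ballI)
    fix m assume "m \<in> Poly_Mapping.keys (p + q)"
    from subsetD[OF Poly_Mapping.keys_add this] that show "Poly_Mapping.keys m \<subseteq> X"
      by (elim UnE) simp_all
  qed
  let ?R = "mpoly_ring X :: ('x, 'k) mpoly ring"
  have R: "carrier ?R = ?C" "\<And>p q. p \<otimes>\<^bsub>?R\<^esub> q = p * q" "\<And>p q. p \<oplus>\<^bsub>?R\<^esub> q = p + q"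
    "\<one>\<^bsub>?R\<^esub> = 1" "\<zero>\<^bsub>?R\<^esub> = 0"
    by (simp_all add: mpoly_ring_def)
  show "abelian_group ?R"
  proof (rule abelian_groupI, unfold R)
    fix p assume "p \<in> ?C"
    then have "- p \<in> ?C" "- p + p = 0" by simp_all
    then show "\<exists>q \<in> ?C. q + p = 0" ..
  qed (fact add add.assoc add.commute | simp)+
  show "Group.comm_monoid ?R"
    by (rule comm_monoidI, unfold R) (fact mult mult.assoc mult.commute | simp)+
qed (simp add: mpoly_ring_def distrib_right)

definition mpoly_const :: "'k \<Rightarrow> ('x, 'k::comm_ring_1) mpoly" where
  "mpoly_const c = Poly_Mapping.single 0 c"

definition mpoly_var :: "'x \<Rightarrow> ('x, 'k::comm_ring_1) mpoly" where
  "mpoly_var x = Poly_Mapping.single (Poly_Mapping.single x 1) 1"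

definition monomials :: "'x set \<Rightarrow> ('x, 'k::comm_ring_1) mpoly set" where
  "monomials X = {Poly_Mapping.single m 1 | m. Poly_Mapping.keys m \<subseteq> X}"

text \<open>
  The ring homomorphism that is \<open>\<iota>\<close> on coefficients and sends each variable \<open>x\<close> to \<open>g x\<close>.
\<close>

definition mpoly_eval ::
    "('k::comm_ring_1 \<Rightarrow> 'a::comm_ring_1) \<Rightarrow> ('x \<Rightarrow> 'a) \<Rightarrow> ('x, 'k) mpoly \<Rightarrow> 'a" where
  "mpoly_eval \<iota> g p =
     (\<Sum>m \<in> Poly_Mapping.keys p. \<iota> (Poly_Mapping.lookup p m) *
        (\<Prod>x \<in> Poly_Mapping.keys m. g x ^ Poly_Mapping.lookup m x))"

definition radical :: "('a, 'b) ring_scheme \<Rightarrow> 'a set \<Rightarrow> 'a set" where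
  "radical R I = {a \<in> carrier R. \<exists>n::nat. a [^]\<^bsub>R\<^esub> n \<in> I}"

text \<open>
  Every monomial ideal of \<open>\<k>[X]\<close> has exactly one set of monomials that generates it and is
  minimal for inclusion among such sets.
\<close>

definition minimal_monomial_generators ::
    "'x set \<Rightarrow> ('x, 'k::field) mpoly set \<Rightarrow> ('x, 'k) mpoly set" where
  "minimal_monomial_generators X I =
     (THE G. G \<subseteq> monomials X \<and> Idl\<^bsub>mpoly_ring X\<^esub> G = I \<and>
             (\<forall>H. H \<subset> G \<longrightarrow> Idl\<^bsub>mpoly_ring X\<^esub> H \<noteq> I))"


section \<open>Clutters, edge ideals and ideals of covers\<close>

text \<open>A clutter is given by its vertex set \<open>X\<close> and its set \<open>E\<close> of edges.\<close>

definition clutter :: "'x set \<Rightarrow> 'x set set \<Rightarrow> bool" where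
  "clutter X E \<longleftrightarrow> (\<forall>e \<in> E. e \<subseteq> X) \<and> (\<forall>e \<in> E. \<forall>e' \<in> E. e \<subseteq> e' \<longrightarrow> e = e')"

definition edge_monomials :: "'x set set \<Rightarrow> ('x, 'k::field) mpoly set" where
  "edge_monomials E = (\<lambda>e. \<Prod>x\<in>e. mpoly_var x) ` E"

definition edge_ideal :: "'x set \<Rightarrow> 'x set set \<Rightarrow> ('x, 'k::field) mpoly set" where
  "edge_ideal X E = Idl\<^bsub>mpoly_ring X\<^esub> (edge_monomials E)"

definition vertex_cover :: "'x set \<Rightarrow> 'x set set \<Rightarrow> 'x set \<Rightarrow> bool" where
  "vertex_cover X E W \<longleftrightarrow> W \<subseteq> X \<and> (\<forall>e \<in> E. W \<inter> e \<noteq> {})"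

definition minimal_vertex_cover :: "'x set \<Rightarrow> 'x set set \<Rightarrow> 'x set \<Rightarrow> bool" where
  "minimal_vertex_cover X E W \<longleftrightarrow>
     vertex_cover X E W \<and> (\<forall>V. V \<subset> W \<longrightarrow> \<not> vertex_cover X E V)"

definition cover_ideal :: "'x set \<Rightarrow> 'x set set \<Rightarrow> ('x, 'k::field) mpoly set" where
  "cover_ideal X E =
     Idl\<^bsub>mpoly_ring X\<^esub> {\<Prod>w\<in>W. mpoly_var w | W. minimal_vertex_cover X E W}"

text \<open>
  The power is taken in the semiring of ideals, whose product is the product of ideals.
  The intersection is formed inside \<open>\<k>[X]\<close>, so it is the whole ring if there are no edges.
\<close>

definition cover_ideal_symbolic_power ::
    "'x set \<Rightarrow> 'x set set \<Rightarrow> nat \<Rightarrow> ('x, 'k::field) mpoly set" where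
  "cover_ideal_symbolic_power X E k =
     carrier (mpoly_ring X) \<inter>
     (\<Inter>e \<in> E. (Idl\<^bsub>mpoly_ring X\<^esub> (mpoly_var ` e)) [^]\<^bsub>ideals_set (mpoly_ring X)\<^esub> k)"


section \<open>Jets\<close>

text \<open>The jet variable \<open>x\<^sub>i\<close> is the pair \<open>(x, i)\<close>.\<close>

definition jet_vars :: "nat \<Rightarrow> 'x set \<Rightarrow> ('x \<times> nat) set" where
  "jet_vars s X = (\<Union>x \<in> X. {(x, i) | i. i \<le> s})"

text \<open>
  \<open>jet_hom s f\<close> is a representative of \<open>\<phi>\<^sub>s(f)\<close> in the polynomials in \<open>t\<close> over the ring of jet
  variables.  Reduction modulo \<open>t\<^bsup>s+1\<^esup>\<close> does not change the coefficients of \<open>t\<^sup>j\<close> for \<open>j \<le> s\<close>,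
  and only these are used below.
\<close>

definition jet_hom :: "nat \<Rightarrow> ('x, 'k::field) mpoly \<Rightarrow> ('x \<times> nat, 'k) mpoly poly" where
  "jet_hom s = mpoly_eval (\<lambda>c. [:mpoly_const c:]) (\<lambda>x. \<Sum>j\<le>s. monom (mpoly_var (x, j)) j)"

text \<open>
  The ideal of \<open>s\<close>-jets of the ideal generated by \<open>F\<close>.  It depends only on the ideal
  generated by \<open>F\<close> in \<open>\<k>[X]\<close>, since \<open>\<phi>\<^sub>s\<close> is a homomorphism.
\<close>

definition jet_ideal ::
    "nat \<Rightarrow> 'x set \<Rightarrow> ('x, 'k::field) mpoly set \<Rightarrow> ('x \<times> nat, 'k) mpoly set" where
  "jet_ideal s X F = Idl\<^bsub>mpoly_ring (jet_vars s X)\<^esub> {coeff (jet_hom s f) j | f j. f \<in> F \<and> j \<le> s}"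

text \<open>
  The clutter of \<open>s\<close>-jets is the clutter on the jet variables whose edge ideal is the radical of
  the ideal of \<open>s\<close>-jets of the edge ideal.  The type argument is the field of coefficients.
\<close>

definition jet_clutter ::
    "'k::field itself \<Rightarrow> nat \<Rightarrow> 'x set \<Rightarrow> 'x set set \<Rightarrow> ('x \<times> nat) set set" where
  "jet_clutter _ s X E =
     (THE D. clutter (jet_vars s X) D \<and>
        edge_ideal (jet_vars s X) D =
          radical (mpoly_ring (jet_vars s X))
            (jet_ideal s X (edge_monomials E :: ('x, 'k) mpoly set)))"

definition depolarization :: "('x \<times> nat, 'k::field) mpoly \<Rightarrow> ('x, 'k) mpoly" where
  "depolarization = mpoly_eval mpoly_const (\<lambda>(x, i). mpoly_var x)"

end

theory Submission
  imports Defs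
begin

text \<open>
  All ideals involved are monomial ideals, so everything reduces to sets of exponents closed
  under taking multiples.  The radical of the jet ideal of \<open>x\<^sub>1 \<cdots> x\<^sub>r\<close> is generated by the
  products of variables \<open>(x\<^sub>1, i\<^sub>1), \<dots>, (x\<^sub>r, i\<^sub>r)\<close> with \<open>i\<^sub>1 + \<dots> + i\<^sub>r \<le> s\<close>, by induction on
  this sum.  A set of jet variables covers all of these products if and only if the least
  indices \<open>a\<^sub>x\<close> missing from it satisfy \<open>\<Sum>\<^bsub>x\<in>e\<^esub> a\<^sub>x \<ge> s + 1\<close> for every edge \<open>e\<close>, which is the
  condition for the monomial with exponents \<open>a\<close> to lie in the symbolic power.  Minimal covers
  are therefore the initial segments \<open>{(x, i). i < a\<^sub>x}\<close> given by minimal such \<open>a\<close>, and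
  polarization inverts depolarization on minimal generators.
\<close>

abbreviation supp :: "('a \<Rightarrow>\<^sub>0 'b::zero) \<Rightarrow> 'a set" where
  "supp \<equiv> Poly_Mapping.keys"

abbreviation coef :: "('a \<Rightarrow>\<^sub>0 'b::zero) \<Rightarrow> 'a \<Rightarrow> 'b" where
  "coef \<equiv> Poly_Mapping.lookup"

abbreviation xpow :: "('x \<Rightarrow>\<^sub>0 nat) \<Rightarrow> ('x, 'k::comm_ring_1) mpoly" where
  "xpow m \<equiv> Poly_Mapping.single m 1"

section \<open>Ideals of the polynomial ring\<close>

lemma mpoly_ring_simps [simp]:
  "carrier (mpoly_ring X) = {p. \<forall>m \<in> supp p. supp m \<subseteq> X}"
  "p \<otimes>\<^bsub>mpoly_ring X\<^esub> q = p * q"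
  "p \<oplus>\<^bsub>mpoly_ring X\<^esub> q = p + q"
  "\<one>\<^bsub>mpoly_ring X\<^esub> = 1"
  "\<zero>\<^bsub>mpoly_ring X\<^esub> = 0"
  by (simp_all add: mpoly_ring_def)

lemma ring_mpoly_ring: "ring (mpoly_ring X)"
  using cring_mpoly_ring by (rule cring.axioms(1))

lemma mpoly_ring_a_inv:
  fixes p :: "('x, 'k::comm_ring_1) mpoly"
  assumes "p \<in> carrier (mpoly_ring X)"
  shows "\<ominus>\<^bsub>mpoly_ring X\<^esub> p = - p"
proof -
  interpret cring "mpoly_ring X :: ('x, 'k) mpoly ring" by (rule cring_mpoly_ring)
  show ?thesis
    by (rule minus_equality) (use assms in simp_all)
qed

lemma mpoly_ring_nat_pow:
  "p [^]\<^bsub>mpoly_ring X\<^esub> (n::nat) = p ^ n"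
  by (induction n) (simp_all add: nat_pow_def mult.commute)

lemma mpoly_idealI:
  fixes I :: "('x, 'k::comm_ring_1) mpoly set"
  assumes sub: "I \<subseteq> carrier (mpoly_ring X)" and zero: "0 \<in> I"
    and add: "\<And>p q. p \<in> I \<Longrightarrow> q \<in> I \<Longrightarrow> p + q \<in> I"
    and mult: "\<And>p q. p \<in> carrier (mpoly_ring X) \<Longrightarrow> q \<in> I \<Longrightarrow> p * q \<in> I"
  shows "ideal I (mpoly_ring X)"
proof (rule idealI[OF ring_mpoly_ring])
  interpret cring "mpoly_ring X :: ('x, 'k) mpoly ring" by (rule cring_mpoly_ring)
  have neg: "- p \<in> I" if "p \<in> I" for p
    using mult[of "- 1" p] that by simp
  show "subgroup I (add_monoid (mpoly_ring X))"
  proof (rule add.subgroupI)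
    show "I \<noteq> {}" using zero by blast
    show "\<ominus>\<^bsub>mpoly_ring X\<^esub> p \<in> I" if "p \<in> I" for p
      using neg[OF that] mpoly_ring_a_inv[of p X] that sub by auto
  qed (use sub add in auto)
  fix a x :: "('x, 'k) mpoly"
  assume a: "a \<in> I" "x \<in> carrier (mpoly_ring X)"
  show "x \<otimes>\<^bsub>mpoly_ring X\<^esub> a \<in> I" "a \<otimes>\<^bsub>mpoly_ring X\<^esub> x \<in> I"
    using mult[OF a(2,1)] by (simp_all add: mult.commute)
qed

lemma
  fixes I :: "('x, 'k::comm_ring_1) mpoly set"
  assumes "ideal I (mpoly_ring X)"
  shows mpoly_ideal_carrier: "p \<in> I \<Longrightarrow> p \<in> carrier (mpoly_ring X)"
    and mpoly_ideal_zero: "0 \<in> I"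
    and mpoly_ideal_add: "p \<in> I \<Longrightarrow> q \<in> I \<Longrightarrow> p + q \<in> I"
    and mpoly_ideal_mult: "r \<in> carrier (mpoly_ring X) \<Longrightarrow> q \<in> I \<Longrightarrow> r * q \<in> I"
    and mpoly_ideal_uminus: "p \<in> I \<Longrightarrow> - p \<in> I"
proof -
  interpret ideal I "mpoly_ring X" by fact
  show "p \<in> I \<Longrightarrow> p \<in> carrier (mpoly_ring X)" by (rule Icarr)
  show "0 \<in> I" using additive_subgroup.zero_closed[OF is_additive_subgroup] by simp
  show "p \<in> I \<Longrightarrow> q \<in> I \<Longrightarrow> p + q \<in> I"
    using additive_subgroup.a_closed[OF is_additive_subgroup, of p q] by simp
  show mult: "r \<in> carrier (mpoly_ring X) \<Longrightarrow> q \<in> I \<Longrightarrow> r * q \<in> I" for r q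
    using I_l_closed[of q r] by simp
  show "p \<in> I \<Longrightarrow> - p \<in> I" using mult[of "- 1" p] by simp
qed

lemma mpoly_ideal_sum:
  assumes "ideal I (mpoly_ring X)" "\<And>a. a \<in> A \<Longrightarrow> f a \<in> I"
  shows "sum f A \<in> I"
  using assms(2)
  by (induction A rule: infinite_finite_induct)
    (auto intro: mpoly_ideal_zero[OF assms(1)] mpoly_ideal_add[OF assms(1)])

lemma mpoly_ideal_diff:
  assumes "ideal I (mpoly_ring X)" "p \<in> I" "q \<in> I"
  shows "p - q \<in> I"
  using mpoly_ideal_add[OF assms(1,2) mpoly_ideal_uminus[OF assms(1,3)]] by simp

section \<open>Monomial ideals\<close>

text \<open>This is the span of the monomials in \<open>X\<close> with exponent in \<open>U\<close>.
  Up-closure of \<open>U\<close> is kept as a separate condition, so that images under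
  depolarization can be written in this form before their closure is known.\<close>

definition monomial_ideal :: "'x set \<Rightarrow> ('x \<Rightarrow>\<^sub>0 nat) set \<Rightarrow> ('x, 'k::comm_ring_1) mpoly set" where
  "monomial_ideal X U = {p. \<forall>m \<in> supp p. supp m \<subseteq> X \<and> m \<in> U}"

definition divides :: "('x \<Rightarrow>\<^sub>0 nat) \<Rightarrow> ('x \<Rightarrow>\<^sub>0 nat) \<Rightarrow> bool" where
  "divides m n \<longleftrightarrow> (\<forall>x. coef m x \<le> coef n x)"

definition up_closed :: "('x \<Rightarrow>\<^sub>0 nat) set \<Rightarrow> bool" where
  "up_closed U \<longleftrightarrow> (\<forall>m\<in>U. \<forall>n. divides m n \<longrightarrow> n \<in> U)"

definition multiples :: "('x \<Rightarrow>\<^sub>0 nat) set \<Rightarrow> ('x \<Rightarrow>\<^sub>0 nat) set" where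
  "multiples M = {n. \<exists>m\<in>M. divides m n}"

definition minimal_exponents :: "('x \<Rightarrow>\<^sub>0 nat) set \<Rightarrow> ('x \<Rightarrow>\<^sub>0 nat) set" where
  "minimal_exponents U = {m \<in> U. \<forall>n\<in>U. divides n m \<longrightarrow> n = m}"

lemma divides_refl [simp]: "divides m m"
  by (simp add: divides_def)

lemma divides_trans: "divides l m \<Longrightarrow> divides m n \<Longrightarrow> divides l n"
  unfolding divides_def using le_trans by blast

lemma divides_add [simp]: "divides m (m + n)" "divides n (m + n)"
  by (simp_all add: divides_def lookup_add)

lemma divides_supp: "divides m n \<Longrightarrow> supp m \<subseteq> supp n"
  unfolding divides_def subset_iff in_keys_iff by (metis le_zero_eq)

lemma divides_diff: "divides m n \<Longrightarrow> n = m + (n - m)"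
  by (rule poly_mapping_eqI) (simp add: divides_def lookup_add lookup_minus)

lemma supp_add: "supp (m + n) = supp m \<union> supp n" for m n :: "'x \<Rightarrow>\<^sub>0 nat"
  by (auto simp: in_keys_iff lookup_add)

lemma supp_diff: "supp (m - n) \<subseteq> supp m" for m n :: "'x \<Rightarrow>\<^sub>0 nat"
  by (auto simp: in_keys_iff lookup_minus)

lemma up_closed_multiples: "up_closed (multiples M)"
  unfolding up_closed_def multiples_def using divides_trans by blast

lemma multiples_self: "m \<in> M \<Longrightarrow> m \<in> multiples M"
  unfolding multiples_def using divides_refl by blast

lemma up_closedD: "up_closed U \<Longrightarrow> m \<in> U \<Longrightarrow> divides m n \<Longrightarrow> n \<in> U"
  by (auto simp: up_closed_def)

text \<open>Divisors of \<open>n\<close> are supported on \<open>supp n\<close>, where the sum of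
  the exponents drops strictly under proper division. A divisor of \<open>n\<close> in
  \<open>U\<close> with the least such sum is therefore minimal.\<close>

lemma divides_minimal_exponent:
  assumes "n \<in> U"
  obtains m where "m \<in> minimal_exponents U" "divides m n"
proof -
  define deg :: "('a \<Rightarrow>\<^sub>0 nat) \<Rightarrow> nat" where "deg m = (\<Sum>x\<in>supp n. coef m x)" for m
  obtain m where m: "m \<in> U" "divides m n"
    and least: "\<And>l. l \<in> U \<Longrightarrow> divides l n \<Longrightarrow> deg m \<le> deg l"
    using ex_has_least_nat[of "\<lambda>m. m \<in> U \<and> divides m n" n deg] assms by auto
  have "l = m" if l: "l \<in> U" "divides l m" for l
  proof (rule ccontr)
    assume "l \<noteq> m"
    then obtain x where x: "coef l x \<noteq> coef m x"
      by (meson poly_mapping_eqI)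
    have "coef l x < coef m x"
      using l(2) x by (simp add: divides_def order.strict_iff_order)
    moreover have "x \<in> supp n"
      using calculation divides_supp[OF m(2)] by (auto simp: in_keys_iff subset_iff)
    ultimately have "deg l < deg m"
      unfolding deg_def using l(2) by (intro sum_strict_mono_ex1) (auto simp: divides_def)
    moreover have "divides l n" using l(2) m(2) by (rule divides_trans)
    ultimately show False using least[of l] l(1) by simp
  qed
  with m have "m \<in> minimal_exponents U" by (simp add: minimal_exponents_def)
  with m that show thesis by blast
qed

lemma mpoly_sum_terms:
  fixes p :: "'a \<Rightarrow>\<^sub>0 'b::comm_monoid_add"
  shows "p = (\<Sum>m\<in>supp p. Poly_Mapping.single m (coef p m))"
  by (rule poly_mapping_eqI) (simp add: lookup_sum lookup_single when_def in_keys_iff)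

lemma xpow_in_monomial_ideal [simp]:
  "xpow m \<in> (monomial_ideal X U :: ('x, 'k::comm_ring_1) mpoly set) \<longleftrightarrow> supp m \<subseteq> X \<and> m \<in> U"
  by (simp add: monomial_ideal_def)

lemma ideal_monomial_ideal:
  assumes "up_closed U"
  shows "ideal (monomial_ideal X U) (mpoly_ring X)"
proof (rule mpoly_idealI)
  show "p + q \<in> monomial_ideal X U" if "p \<in> monomial_ideal X U" "q \<in> monomial_ideal X U"
    for p q :: "('a, 'b) mpoly"
    using that Poly_Mapping.keys_add[of p q] unfolding monomial_ideal_def by blast
  show "p * q \<in> monomial_ideal X U"
    if p: "p \<in> carrier (mpoly_ring X)" and q: "q \<in> monomial_ideal X U" for p q :: "('a, 'b) mpoly"
    unfolding monomial_ideal_def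
  proof (intro CollectI ballI)
    fix m assume "m \<in> supp (p * q)"
    then obtain a b where ab: "m = a + b" "a \<in> supp p" "b \<in> supp q"
      using Poly_Mapping.keys_mult[of p q] by blast
    then show "supp m \<subseteq> X \<and> m \<in> U"
      using p q up_closedD[OF assms, of b m]
      by (auto simp: monomial_ideal_def supp_add)
  qed
qed (auto simp: monomial_ideal_def)

text \<open>A term of exponent \<open>n\<close> divisible by \<open>m \<in> M\<close> is its
  coefficient times \<open>xpow (n - m)\<close> times \<open>xpow m\<close>, and a polynomial is the
  sum of its terms.\<close>

lemma monomial_ideal_subset:
  fixes I :: "('x, 'k::comm_ring_1) mpoly set"
  assumes I: "ideal I (mpoly_ring X)" and M: "\<And>m. m \<in> M \<Longrightarrow> xpow m \<in> I"
  shows "monomial_ideal X (multiples M) \<subseteq> I"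
proof
  fix p :: "('x, 'k) mpoly" assume p: "p \<in> monomial_ideal X (multiples M)"
  have "Poly_Mapping.single n (coef p n) \<in> I" if n: "n \<in> supp p" for n
  proof -
    obtain m where m: "m \<in> M" "divides m n" and X: "supp n \<subseteq> X"
      using p n by (auto simp: monomial_ideal_def multiples_def)
    have "Poly_Mapping.single (n - m) (coef p n) * xpow m \<in> I"
      using X supp_diff[of n m] by (intro mpoly_ideal_mult[OF I] M m(1)) auto
    also have "Poly_Mapping.single (n - m) (coef p n) * xpow m = Poly_Mapping.single n (coef p n)"
      using divides_diff[OF m(2)] by (simp add: mult_single add.commute)
    finally show ?thesis .
  qed
  then show "p \<in> I"
    by (subst mpoly_sum_terms) (intro mpoly_ideal_sum[OF I])
qed

lemma genideal_monomials:
  assumes "\<And>m. m \<in> M \<Longrightarrow> supp m \<subseteq> X"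
  shows "Idl\<^bsub>mpoly_ring X\<^esub> (xpow ` M) = (monomial_ideal X (multiples M) :: ('x, 'k::comm_ring_1) mpoly set)"
proof
  interpret cring "mpoly_ring X :: ('x, 'k) mpoly ring" by (rule cring_mpoly_ring)
  have sub: "xpow ` M \<subseteq> (monomial_ideal X (multiples M) :: ('x, 'k) mpoly set)"
    by (rule image_subsetI) (simp add: assms multiples_self)
  show "Idl\<^bsub>mpoly_ring X\<^esub> (xpow ` M) \<subseteq> (monomial_ideal X (multiples M) :: ('x, 'k) mpoly set)"
    by (rule genideal_minimal[OF ideal_monomial_ideal[OF up_closed_multiples] sub])
  have carr: "xpow ` M \<subseteq> carrier (mpoly_ring X :: ('x, 'k) mpoly ring)"
    by (rule image_subsetI) (simp add: assms)
  show "(monomial_ideal X (multiples M) :: ('x, 'k) mpoly set) \<subseteq> Idl\<^bsub>mpoly_ring X\<^esub> (xpow ` M)"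
    by (rule monomial_ideal_subset[OF genideal_ideal[OF carr]])
      (rule subsetD[OF genideal_self[OF carr] imageI])
qed

lemma monomial_ideal_eq_iff:
  "(monomial_ideal X U :: ('x, 'k::comm_ring_1) mpoly set) = monomial_ideal X V \<longleftrightarrow>
     (\<forall>m. supp m \<subseteq> X \<longrightarrow> (m \<in> U \<longleftrightarrow> m \<in> V))"
proof
  assume eq: "(monomial_ideal X U :: ('x, 'k) mpoly set) = monomial_ideal X V"
  show "\<forall>m. supp m \<subseteq> X \<longrightarrow> (m \<in> U \<longleftrightarrow> m \<in> V)"
    using xpow_in_monomial_ideal[of _ X U, where ?'k = 'k] xpow_in_monomial_ideal[of _ X V, where ?'k = 'k] eq
    by blast
qed (auto simp: monomial_ideal_def)

lemma xpow_eq_iff: "xpow m = (xpow n :: ('x, 'k::comm_ring_1) mpoly) \<longleftrightarrow> m = n"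
  by (metis keys_single singleton_inject zero_neq_one)

section \<open>Minimal monomial generators\<close>

lemma multiples_minimal_exponents:
  assumes "up_closed U" "supp m \<subseteq> X"
  shows "m \<in> multiples {n \<in> minimal_exponents U. supp n \<subseteq> X} \<longleftrightarrow> m \<in> U"
proof
  assume "m \<in> U"
  then obtain n where "n \<in> minimal_exponents U" "divides n m"
    by (rule divides_minimal_exponent)
  then show "m \<in> multiples {n \<in> minimal_exponents U. supp n \<subseteq> X}"
    using divides_supp[of n m] assms(2) by (auto simp: multiples_def)
qed (use assms(1) in \<open>auto simp: multiples_def minimal_exponents_def up_closed_def\<close>)

text \<open>A minimal exponent \<open>m\<close> belongs to every monomial generating set: some
  generator divides it, that generator lies in \<open>U\<close>, and minimality makes the two equal.
  As the minimal exponents also generate, they give the least generating set.\<close>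

lemma minimal_monomial_generators_monomial_ideal:
  assumes U: "up_closed U"
  shows "minimal_monomial_generators X (monomial_ideal X U :: ('x, 'k::field) mpoly set)
           = xpow ` {m \<in> minimal_exponents U. supp m \<subseteq> X}"
proof -
  define M where "M = {m \<in> minimal_exponents U. supp m \<subseteq> X}"
  have Idl_M: "Idl\<^bsub>mpoly_ring X\<^esub> (xpow ` M) = (monomial_ideal X U :: ('x, 'k) mpoly set)"
    using multiples_minimal_exponents[OF U]
    by (subst genideal_monomials) (auto simp: M_def monomial_ideal_eq_iff)
  have above: "M \<subseteq> N"
    if N: "\<And>n. n \<in> N \<Longrightarrow> supp n \<subseteq> X"
      and eq: "Idl\<^bsub>mpoly_ring X\<^esub> (xpow ` N) = (monomial_ideal X U :: ('x, 'k) mpoly set)" for N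
  proof
    fix m assume m: "m \<in> M"
    have iff: "n \<in> multiples N \<longleftrightarrow> n \<in> U" if "supp n \<subseteq> X" for n
      using eq that by (simp add: genideal_monomials N monomial_ideal_eq_iff)
    have "m \<in> multiples N" using m iff[of m] by (auto simp: M_def minimal_exponents_def)
    then obtain n where n: "n \<in> N" "divides n m" by (auto simp: multiples_def)
    then have "n \<in> U" using iff[of n] N by (auto simp: multiples_def intro: divides_refl)
    then have "n = m" using m n(2) by (auto simp: M_def minimal_exponents_def)
    with n show "m \<in> N" by simp
  qed
  have rep: "\<exists>N. G = xpow ` N \<and> (\<forall>n\<in>N. supp n \<subseteq> X)" if "G \<subseteq> monomials X"
    for G :: "('x, 'k) mpoly set"
    using that by (intro exI[of _ "{n. supp n \<subseteq> X \<and> xpow n \<in> G}"]) (auto simp: monomials_def)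
  have min: "Idl\<^bsub>mpoly_ring X\<^esub> H \<noteq> (monomial_ideal X U :: ('x, 'k) mpoly set)"
    if "H \<subset> xpow ` M" for H
  proof
    assume eq: "Idl\<^bsub>mpoly_ring X\<^esub> H = (monomial_ideal X U :: ('x, 'k) mpoly set)"
    have "H \<subseteq> monomials X" using that by (auto simp: M_def monomials_def)
    then obtain N where "H = xpow ` N" "\<forall>n\<in>N. supp n \<subseteq> X" using rep by blast
    with above[of N] eq that show False by auto
  qed
  show ?thesis unfolding minimal_monomial_generators_def M_def[symmetric]
  proof (rule the_equality)
    have "xpow ` M \<subseteq> (monomials X :: ('x, 'k) mpoly set)" by (auto simp: M_def monomials_def)
    with Idl_M min show "xpow ` M \<subseteq> (monomials X :: ('x, 'k) mpoly set) \<and>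
      Idl\<^bsub>mpoly_ring X\<^esub> (xpow ` M) = (monomial_ideal X U :: ('x, 'k) mpoly set) \<and>
      (\<forall>H. H \<subset> xpow ` M \<longrightarrow> Idl\<^bsub>mpoly_ring X\<^esub> H \<noteq> (monomial_ideal X U :: ('x, 'k) mpoly set))"
      by simp
  next
    fix G :: "('x, 'k) mpoly set"
    assume G: "G \<subseteq> monomials X \<and> Idl\<^bsub>mpoly_ring X\<^esub> G = monomial_ideal X U \<and>
      (\<forall>H. H \<subset> G \<longrightarrow> Idl\<^bsub>mpoly_ring X\<^esub> H \<noteq> monomial_ideal X U)"
    then obtain N where N: "G = xpow ` N" "\<forall>n\<in>N. supp n \<subseteq> X" using rep[of G] by auto
    from G N(1) have "Idl\<^bsub>mpoly_ring X\<^esub> (xpow ` N) = (monomial_ideal X U :: ('x, 'k) mpoly set)"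
      by simp
    with above[of N] N have "xpow ` M \<subseteq> G" by blast
    \<comment> \<open>The monomials of \<open>M\<close> generate already, so minimality of
      \<open>G\<close> excludes a proper inclusion.\<close>
    moreover have "\<not> xpow ` M \<subset> G" using G Idl_M by meson
    ultimately show "G = xpow ` M" by (simp add: psubset_eq)
  qed
qed

section \<open>Radicals\<close>

lemma mpoly_carrier_mult:
  "p \<in> carrier (mpoly_ring X) \<Longrightarrow> q \<in> carrier (mpoly_ring X) \<Longrightarrow> p * q \<in> carrier (mpoly_ring X)"
  using monoid.m_closed[OF ring.is_monoid[OF ring_mpoly_ring], of p X q] by simp

lemma mpoly_carrier_power:
  "p \<in> carrier (mpoly_ring X) \<Longrightarrow> p ^ n \<in> carrier (mpoly_ring X)"
  using monoid.nat_pow_closed[OF ring.is_monoid[OF ring_mpoly_ring], of p X n]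
  by (simp add: mpoly_ring_nat_pow)

lemma mpoly_carrier_add:
  "p \<in> carrier (mpoly_ring X) \<Longrightarrow> q \<in> carrier (mpoly_ring X) \<Longrightarrow> p + q \<in> carrier (mpoly_ring X)"
  using ring.ring_simprules(1)[OF ring_mpoly_ring, of p X q] by simp

lemma radical_mpoly:
  "radical (mpoly_ring X) I = {p \<in> carrier (mpoly_ring X). \<exists>n. p ^ n \<in> I}"
  by (simp add: radical_def mpoly_ring_nat_pow)

lemma mpoly_ideal_power_le:
  assumes I: "ideal I (mpoly_ring X)" and p: "p \<in> carrier (mpoly_ring X)" and "p ^ n \<in> I" "n \<le> k"
  shows "p ^ k \<in> I"
proof -
  have "p ^ (k - n) * p ^ n \<in> I"
    by (rule mpoly_ideal_mult[OF I mpoly_carrier_power[OF p] assms(3)])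
  with \<open>n \<le> k\<close> show ?thesis by (simp flip: power_add)
qed

text \<open>In each term of the binomial expansion of \<open>(p + q) ^ (a + b)\<close>, either
  \<open>p\<close> has exponent at least \<open>a\<close> or \<open>q\<close> has exponent at least
  \<open>b\<close>.\<close>

lemma ideal_radical:
  fixes I :: "('x, 'k::comm_ring_1) mpoly set"
  assumes I: "ideal I (mpoly_ring X)"
  shows "ideal (radical (mpoly_ring X) I) (mpoly_ring X)"
proof (rule mpoly_idealI)
  show "0 \<in> radical (mpoly_ring X) I"
    using mpoly_ideal_zero[OF I] by (auto simp: radical_mpoly intro: exI[of _ 1])
next
  fix p q :: "('x, 'k) mpoly"
  assume "p \<in> radical (mpoly_ring X) I" "q \<in> radical (mpoly_ring X) I"
  then obtain a b where p: "p \<in> carrier (mpoly_ring X)" "p ^ a \<in> I"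
    and q: "q \<in> carrier (mpoly_ring X)" "q ^ b \<in> I"
    unfolding radical_mpoly by blast
  have "of_nat ((a + b) choose i) * p ^ i * q ^ (a + b - i) \<in> I" if "i \<le> a + b" for i
  proof -
    have "(of_nat ((a + b) choose i) :: ('x, 'k) mpoly) \<in> carrier (mpoly_ring X)"
      by (simp flip: single_of_nat)
    moreover have "p ^ i * q ^ (a + b - i) \<in> I"
    proof (cases "a \<le> i")
      case True
      then show ?thesis
        using mpoly_ideal_mult[OF I mpoly_carrier_power[OF q(1)] mpoly_ideal_power_le[OF I p]]
        by (simp add: mult.commute)
    next
      case False
      then show ?thesis
        by (intro mpoly_ideal_mult[OF I mpoly_carrier_power[OF p(1)] mpoly_ideal_power_le[OF I q]]) simp
    qed
    ultimately show ?thesis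
      using mpoly_ideal_mult[OF I] by (simp add: mult.assoc)
  qed
  then have "(p + q) ^ (a + b) \<in> I"
    unfolding binomial_ring by (intro mpoly_ideal_sum[OF I]) simp
  then show "p + q \<in> radical (mpoly_ring X) I"
    unfolding radical_mpoly using mpoly_carrier_add[OF p(1) q(1)] by blast
next
  fix p q :: "('x, 'k) mpoly"
  assume p: "p \<in> carrier (mpoly_ring X)" and "q \<in> radical (mpoly_ring X) I"
  then obtain b where q: "q \<in> carrier (mpoly_ring X)" "q ^ b \<in> I"
    unfolding radical_mpoly by blast
  have "(p * q) ^ b \<in> I"
    unfolding power_mult_distrib by (rule mpoly_ideal_mult[OF I mpoly_carrier_power[OF p] q(2)])
  then show "p * q \<in> radical (mpoly_ring X) I"
    unfolding radical_mpoly using mpoly_carrier_mult[OF p q(1)] by blast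
qed (auto simp: radical_mpoly)

lemma mpoly_ideal_subset_radical:
  assumes I: "ideal I (mpoly_ring X)"
  shows "I \<subseteq> radical (mpoly_ring X) I"
proof
  fix p assume "p \<in> I"
  then have "p \<in> carrier (mpoly_ring X)" "p ^ 1 \<in> I"
    using mpoly_ideal_carrier[OF I] by simp_all
  then show "p \<in> radical (mpoly_ring X) I" unfolding radical_mpoly by blast
qed

text \<open>Parallelogram identity: for b = 2m - a, the squared norms satisfy |a|^2 + |b|^2 = 2|m|^2
  + 2|a - m|^2. If neither a nor b is longer than m, then a - m vanishes.\<close>

lemma finite_sum_eq_double:
  fixes a b m :: "'x \<Rightarrow>\<^sub>0 nat"
  assumes "finite S" "supp a \<subseteq> S" "supp m \<subseteq> S" and ab: "a + b = m + m"
    and "(\<Sum>x\<in>S. (int (coef a x))\<^sup>2) \<le> (\<Sum>x\<in>S. (int (coef m x))\<^sup>2)"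
    and "(\<Sum>x\<in>S. (int (coef b x))\<^sup>2) \<le> (\<Sum>x\<in>S. (int (coef m x))\<^sup>2)"
  shows "a = m"
proof -
  have b: "int (coef b x) = 2 * int (coef m x) - int (coef a x)" for x
    using arg_cong[OF ab, of "\<lambda>p. coef p x"] by (simp add: lookup_add)
  have "(\<Sum>x\<in>S. 2 * (int (coef a x) - int (coef m x))\<^sup>2) =
      (\<Sum>x\<in>S. (int (coef a x))\<^sup>2 + (int (coef b x))\<^sup>2 - 2 * (int (coef m x))\<^sup>2)"
    unfolding b by (rule sum.cong) (simp_all add: power2_eq_square algebra_simps)
  also have "\<dots> \<le> 0"
    using assms(5,6) by (simp add: sum.distrib sum_subtractf flip: sum_distrib_left)
  finally have "(\<Sum>x\<in>S. 2 * (int (coef a x) - int (coef m x))\<^sup>2) = 0"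
    by (intro antisym sum_nonneg) simp_all
  then have *: "coef a x = coef m x" if "x \<in> S" for x
    using \<open>finite S\<close> that by (subst (asm) sum_nonneg_eq_0_iff) auto
  show ?thesis
  proof (rule poly_mapping_eqI)
    show "coef a x = coef m x" for x
    proof (cases "x \<in> S")
      case False
      then have "x \<notin> supp a" "x \<notin> supp m" using assms(2,3) by auto
      then show ?thesis by (simp add: in_keys_iff)
    qed (rule *)
  qed
qed

text \<open>
  A key \<open>m\<close> of \<open>q\<close> of maximal Euclidean norm is not the midpoint of two other keys, so the
  coefficient of \<open>2m\<close> in \<open>q\<^sup>2\<close> is the square of that of \<open>m\<close>.
\<close>

lemma double_exponent_in_square:
  fixes q :: "('x, 'k::field) mpoly"
  assumes "q \<noteq> 0"
  obtains m where "m \<in> supp q" "m + m \<in> supp (q * q)"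
proof -
  define S where "S = (\<Union>m\<in>supp q. supp m)"
  define N where "N m = (\<Sum>x\<in>S. (int (coef m x))\<^sup>2)" for m
  have "supp q \<noteq> {}" using assms by simp
  then have "Max (N ` supp q) \<in> N ` supp q" by (intro Max_in) simp_all
  then obtain m where m: "m \<in> supp q" and "N m = Max (N ` supp q)" by auto
  then have max: "N a \<le> N m" if "a \<in> supp q" for a using that by simp
  have S: "finite S" "\<And>a. a \<in> supp q \<Longrightarrow> supp a \<subseteq> S" by (auto simp: S_def)
  have iff: "a + b = m + m \<longleftrightarrow> a = m \<and> b = m" if "a \<in> supp q" "b \<in> supp q" for a b
  proof
    assume ab: "a + b = m + m"
    from ab have ba: "b + a = m + m" by (simp add: add.commute)
    show "a = m \<and> b = m"
      using finite_sum_eq_double[OF S(1) S(2) S(2) ab] finite_sum_eq_double[OF S(1) S(2) S(2) ba]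
        max m that unfolding N_def by blast
  qed simp
  have "q * q = (\<Sum>a\<in>supp q. \<Sum>b\<in>supp q. Poly_Mapping.single (a + b) (coef q a * coef q b))"
    by (subst (1 2) mpoly_sum_terms) (simp only: sum_product mult_single)
  then have "coef (q * q) (m + m) =
      (\<Sum>a\<in>supp q. \<Sum>b\<in>supp q. if a + b = m + m then coef q a * coef q b else 0)"
    by (simp add: lookup_sum lookup_single when_def)
  also have "\<dots> = (\<Sum>a\<in>supp q. \<Sum>b\<in>supp q. if b = m then if a = m then coef q a * coef q b else 0 else 0)"
    by (intro sum.cong refl) (simp add: iff)
  also have "\<dots> = coef q m * coef q m" using m by (simp add: sum.delta)
  finally have "m + m \<in> supp (q * q)" using m by (simp add: in_keys_iff)
  with m that show thesis by blast
qed

text \<open>Let \<open>q\<close> be the part of \<open>p\<close> with exponents outside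
  \<open>U\<close>. Then \<open>q * q = p * p - (p + q) * (p - q)\<close> lies in the ideal. A
  nonzero \<open>q\<close> would have an exponent \<open>m\<close> outside \<open>U\<close> with
  \<open>m + m\<close> in the support of \<open>q * q\<close>, against \<open>sq\<close>.\<close>

lemma monomial_ideal_square:
  fixes p :: "('x, 'k::field) mpoly"
  assumes U: "up_closed U" and sq: "\<And>m. m + m \<in> U \<Longrightarrow> m \<in> U"
    and p: "p \<in> carrier (mpoly_ring X)" "p * p \<in> monomial_ideal X U"
  shows "p \<in> monomial_ideal X U"
proof -
  let ?I = "monomial_ideal X U :: ('x, 'k) mpoly set"
  note I = ideal_monomial_ideal[OF U, of X, where ?'b = 'k]
  define q where "q = (\<Sum>m\<in>supp p - U. Poly_Mapping.single m (coef p m))"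
  have coef_q: "coef q m = (if m \<in> U then 0 else coef p m)" for m
    by (auto simp: q_def lookup_sum lookup_single when_def in_keys_iff)
  have q: "q \<in> carrier (mpoly_ring X)" using p(1) by (auto simp: in_keys_iff coef_q split: if_splits)
  have "p - q \<in> ?I"
    using p(1) by (auto simp: monomial_ideal_def in_keys_iff lookup_minus coef_q split: if_splits)
  then have "(p + q) * (p - q) \<in> ?I"
    by (rule mpoly_ideal_mult[OF I mpoly_carrier_add[OF p(1) q]])
  then have "p * p - (p + q) * (p - q) \<in> ?I"
    by (rule mpoly_ideal_diff[OF I p(2)])
  then have qq: "q * q \<in> ?I" by (simp add: algebra_simps)
  have "q = 0"
  proof (rule ccontr)
    assume "q \<noteq> 0"
    then obtain m where "m \<in> supp q" "m + m \<in> supp (q * q)" by (rule double_exponent_in_square)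
    with qq sq[of m] show False by (auto simp: monomial_ideal_def in_keys_iff coef_q split: if_splits)
  qed
  with \<open>p - q \<in> ?I\<close> show ?thesis by simp
qed

lemma radical_monomial_ideal:
  assumes U: "up_closed U" and sq: "\<And>m. m + m \<in> U \<Longrightarrow> m \<in> U"
  shows "radical (mpoly_ring X) (monomial_ideal X U) = (monomial_ideal X U :: ('x, 'k::field) mpoly set)"
proof
  note I = ideal_monomial_ideal[OF U, of X, where ?'b = 'k]
  show "radical (mpoly_ring X) (monomial_ideal X U) \<subseteq> (monomial_ideal X U :: ('x, 'k) mpoly set)"
  proof
    fix p :: "('x, 'k) mpoly" assume "p \<in> radical (mpoly_ring X) (monomial_ideal X U)"
    then obtain n where p: "p \<in> carrier (mpoly_ring X)" and n: "p ^ n \<in> monomial_ideal X U"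
      unfolding radical_mpoly by blast
    \<comment> \<open>Raising the exponent to a power of two allows square roots to be extracted
      repeatedly; \<open>n \<le> 2 ^ n\<close> starts the descent.\<close>
    have "p ^ (2 ^ k) \<in> monomial_ideal X U \<Longrightarrow> p \<in> monomial_ideal X U" for k
    proof (induction k)
      case (Suc k)
      then have "p ^ (2 ^ k) * p ^ (2 ^ k) \<in> monomial_ideal X U"
        by (simp add: mult_2 flip: power_add)
      then show ?case
        by (intro Suc.IH monomial_ideal_square[OF U sq mpoly_carrier_power[OF p]])
    qed simp
    with mpoly_ideal_power_le[OF I p n, of "2 ^ n"] show "p \<in> monomial_ideal X U"
      using less_exp[of n] by simp
  qed
qed (rule mpoly_ideal_subset_radical[OF ideal_monomial_ideal[OF U]])

section \<open>Clutters of jets\<close>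

text \<open>Exponent of the squarefree monomial on \<open>e\<close>. Sums over infinite sets are 0,
  so this is the indicator function only for finite \<open>e\<close>.\<close>

definition ind :: "'x set \<Rightarrow> 'x \<Rightarrow>\<^sub>0 nat" where
  "ind e = (\<Sum>x\<in>e. Poly_Mapping.single x 1)"

lemma coef_ind: "finite e \<Longrightarrow> coef (ind e) x = (if x \<in> e then 1 else 0)"
  by (simp add: ind_def lookup_sum lookup_single when_def)

lemma supp_ind: "finite e \<Longrightarrow> supp (ind e) = e"
  by (auto simp: in_keys_iff coef_ind split: if_splits)

lemma ind_divides_iff: "finite e \<Longrightarrow> divides (ind e) m \<longleftrightarrow> e \<subseteq> supp m"
  by (auto simp: divides_def coef_ind in_keys_iff Suc_le_eq)

lemma prod_mpoly_var: "(\<Prod>x\<in>e. mpoly_var x) = xpow (ind e)"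
  by (induction e rule: infinite_finite_induct) (auto simp: ind_def mpoly_var_def mult_single)

lemma multiples_ind:
  "(\<And>e. e \<in> D \<Longrightarrow> finite e) \<Longrightarrow> multiples (ind ` D) = {m. \<exists>e\<in>D. e \<subseteq> supp m}"
  by (auto simp: multiples_def ind_divides_iff)

lemma genideal_squarefree:
  assumes "finite X" "\<And>e. e \<in> D \<Longrightarrow> e \<subseteq> X"
  shows "Idl\<^bsub>mpoly_ring X\<^esub> (xpow ` ind ` D) =
           (monomial_ideal X {m. \<exists>e\<in>D. e \<subseteq> supp m} :: ('x, 'k::comm_ring_1) mpoly set)"
proof -
  have fin: "finite e" if "e \<in> D" for e using assms(2)[OF that] assms(1) by (rule finite_subset)
  have "supp (ind e) \<subseteq> X" if "e \<in> D" for e using assms(2)[OF that] by (simp add: supp_ind fin that)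
  then have "supp m \<subseteq> X" if "m \<in> ind ` D" for m using that by blast
  then show ?thesis by (simp add: genideal_monomials multiples_ind fin)
qed

lemma edge_monomials_xpow: "edge_monomials E = xpow ` ind ` E"
  by (simp add: edge_monomials_def prod_mpoly_var image_image)

lemma edge_ideal_eq_monomial_ideal:
  assumes "finite X" "\<And>e. e \<in> D \<Longrightarrow> e \<subseteq> X"
  shows "edge_ideal X D = monomial_ideal X {m. \<exists>e\<in>D. e \<subseteq> supp m}"
  unfolding edge_ideal_def edge_monomials_xpow by (rule genideal_squarefree[OF assms])

lemma up_closed_supp: "up_closed {m. \<exists>e\<in>D. e \<subseteq> supp m}"
  unfolding up_closed_def using divides_supp by blast

text \<open>An edge \<open>e\<close> of \<open>D\<close> contains some \<open>d\<close> in
  \<open>D'\<close>, which contains some \<open>c\<close> in \<open>D\<close>; the antichain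
  property of \<open>D\<close> gives \<open>c = e\<close>, hence \<open>d = e\<close>. Used in both
  directions, this shows that the edge ideal determines the clutter.\<close>

lemma clutter_edge_ideal_subset:
  assumes X: "finite X" and D: "clutter X D" and D': "clutter X D'"
    and eq: "(edge_ideal X D :: ('x, 'k::field) mpoly set) = edge_ideal X D'"
  shows "D \<subseteq> D'"
proof
  fix e assume e: "e \<in> D"
  have sub: "e \<subseteq> X" if "e \<in> D \<union> D'" for e using that D D' by (auto simp: clutter_def)
  have iff: "(\<exists>d\<in>D. d \<subseteq> e) \<longleftrightarrow> (\<exists>d\<in>D'. d \<subseteq> e)" if "e \<subseteq> X" for e
  proof -
    have "finite e" using that X by (rule finite_subset)
    then show ?thesis
      using eq that sub
      by (simp add: edge_ideal_eq_monomial_ideal X monomial_ideal_eq_iff)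
        (metis supp_ind)
  qed
  obtain d where d: "d \<in> D'" "d \<subseteq> e" using iff[of e] sub e by blast
  obtain c where c: "c \<in> D" "c \<subseteq> d" using iff[of d] sub d by blast
  then have "c = e" using D e d by (auto simp: clutter_def)
  with c d show "e \<in> D'" by auto
qed

text \<open>A jet edge over \<open>e\<close> picks one index for each vertex of \<open>e\<close>.
  The function is total, but only its values on \<open>e\<close> matter.\<close>

definition graph :: "('x \<Rightarrow> nat) \<Rightarrow> 'x set \<Rightarrow> ('x \<times> nat) set" where
  "graph f e = (\<lambda>x. (x, f x)) ` e"

text \<open>These are the edges given by the theorem of Goward and Smith;
  \<open>jet_clutter_eq\<close> identifies them with the clutter of jets.\<close>

definition jet_edges :: "nat \<Rightarrow> 'x set set \<Rightarrow> ('x \<times> nat) set set" where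
  "jet_edges s E = {graph f e | f e. e \<in> E \<and> sum f e \<le> s}"

lemma finite_graph: "finite e \<Longrightarrow> finite (graph f e)"
  by (simp add: graph_def)

lemma in_graph_iff: "(x, i) \<in> graph f e \<longleftrightarrow> x \<in> e \<and> i = f x"
  by (auto simp: graph_def)

lemma mem_jet_vars_iff: "(x, i) \<in> jet_vars s X \<longleftrightarrow> x \<in> X \<and> i \<le> s"
  by (auto simp: jet_vars_def)

lemma finite_jet_vars: "finite X \<Longrightarrow> finite (jet_vars s X)"
proof -
  assume "finite X"
  moreover have "jet_vars s X = X \<times> {..s}" by (auto simp: jet_vars_def)
  ultimately show ?thesis by simp
qed

lemma graph_subset_jet_vars:
  assumes "finite e" "e \<subseteq> X" "sum f e \<le> s"
  shows "graph f e \<subseteq> jet_vars s X"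
proof -
  have "f x \<le> s" if "x \<in> e" for x
    using member_le_sum[of x e f] that assms by simp
  then show ?thesis using assms(2) by (auto simp: in_graph_iff mem_jet_vars_iff)
qed

lemma jet_edges_subset:
  assumes "finite X" "clutter X E" "d \<in> jet_edges s E"
  shows "d \<subseteq> jet_vars s X"
proof -
  obtain f e where d: "d = graph f e" "e \<in> E" "sum f e \<le> s"
    using assms(3) by (auto simp: jet_edges_def)
  then have "e \<subseteq> X" using assms(2) by (auto simp: clutter_def)
  then show ?thesis unfolding d(1)
    using finite_subset[OF _ assms(1)] d(3) by (intro graph_subset_jet_vars) auto
qed

text \<open>First coordinates recover \<open>e\<close> from its graph, so inclusion of graphs gives
  inclusion of edges. The antichain property of \<open>E\<close> makes the edges equal, and the
  index functions then agree on them.\<close>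

lemma clutter_jet_edges:
  assumes "finite X" "clutter X E"
  shows "clutter (jet_vars s X) (jet_edges s E)"
  unfolding clutter_def
proof (intro conjI ballI impI)
  fix d d' assume "d \<in> jet_edges s E" "d' \<in> jet_edges s E" and sub: "d \<subseteq> d'"
  then obtain f e f' e' where d: "d = graph f e" "e \<in> E" and d': "d' = graph f' e'" "e' \<in> E"
    by (auto simp: jet_edges_def)
  have *: "x \<in> e' \<and> f x = f' x" if "x \<in> e" for x
  proof -
    have "(x, f x) \<in> graph f e" using that by (simp add: in_graph_iff)
    then have "(x, f x) \<in> graph f' e'" using sub d d' by blast
    then show ?thesis by (simp add: in_graph_iff)
  qed
  then have "e \<subseteq> e'" by blast
  then have "e = e'" using assms(2) d(2) d'(2) unfolding clutter_def by blast
  with * show "d = d'" unfolding d d' graph_def by (intro image_cong) auto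
qed (use jet_edges_subset[OF assms] in blast)

section \<open>Jet coefficients and the radical of the jet ideal\<close>

lemma prod_monom: "(\<Prod>x\<in>e. monom (c x) (f x)) = monom (\<Prod>x\<in>e. c x) (sum f e)"
  by (induction e rule: infinite_finite_induct) (auto simp: mult_monom monom_0)

lemma prod_mpoly_var_graph: "(\<Prod>x\<in>e. mpoly_var (x, f x)) = xpow (ind (graph f e))"
  unfolding prod_mpoly_var[symmetric] graph_def
  by (subst prod.reindex) (auto simp: inj_on_def)

text \<open>Expanding the product of sums picks one summand per vertex of \<open>e\<close>, and the
  power of t is the total index. Extensional functions count each choice once.\<close>

lemma coeff_jet_hom:
  assumes "finite e"
  shows "coeff (jet_hom s (xpow (ind e))) j =
           (\<Sum>f | f \<in> e \<rightarrow>\<^sub>E {..s} \<and> sum f e = j. xpow (ind (graph f e)))"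
proof -
  have "jet_hom s (xpow (ind e)) =
      (\<Prod>x\<in>e. \<Sum>j\<le>s. monom (mpoly_var (x, j)) j :: (('a \<times> nat, 'b) mpoly) poly)"
    using assms by (simp add: jet_hom_def mpoly_eval_def supp_ind coef_ind mpoly_const_def pCons_one)
  also have "\<dots> = (\<Sum>f\<in>e \<rightarrow>\<^sub>E {..s}. monom (xpow (ind (graph f e))) (sum f e))"
    using assms by (simp add: prod_sum_PiE prod_monom prod_mpoly_var_graph)
  finally have "coeff (jet_hom s (xpow (ind e))) j =
      (\<Sum>f\<in>e \<rightarrow>\<^sub>E {..s}. if sum f e = j then xpow (ind (graph f e)) else (0 :: ('a \<times> nat, 'b) mpoly))"
    by (simp add: coeff_sum)
  also have "\<dots> = (\<Sum>f | f \<in> e \<rightarrow>\<^sub>E {..s} \<and> sum f e = j. xpow (ind (graph f e)))"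
    using assms by (subst sum.inter_filter[symmetric]) (auto intro: finite_PiE)
  finally show ?thesis .
qed

lemma mpoly_ideal_xpow:
  assumes I: "ideal I (mpoly_ring X)" and "xpow m \<in> I" "divides m n" "supp n \<subseteq> X"
  shows "xpow n \<in> I"
proof -
  have "xpow (n - m) * xpow m \<in> I"
    using assms(4) supp_diff[of n m] by (intro mpoly_ideal_mult[OF I _ assms(2)]) auto
  also have "xpow (n - m) * xpow m = xpow n"
    using divides_diff[OF assms(3)] by (simp add: mult_single add.commute)
  finally show ?thesis .
qed

text \<open>
  With \<open>m\<^sub>f\<close> the monomial of \<open>f\<close> and \<open>F\<^sub>j\<close> the sum of the \<open>m\<^sub>g\<close> with \<open>\<Sum>g = j\<close>, the
  product \<open>m\<^sub>f F\<^sub>j\<close> is \<open>m\<^sub>f\<^sup>2\<close> plus terms \<open>m\<^sub>f m\<^sub>g\<close> with \<open>g \<noteq> f\<close>; such a \<open>g\<close> is somewhere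
  smaller than \<open>f\<close>, so \<open>m\<^sub>f m\<^sub>g\<close> is divisible by some \<open>m\<^sub>h\<close> with \<open>\<Sum>h < j\<close>.
\<close>

lemma xpow_graph_in_radical_jet_ideal:
  fixes f :: "'x \<Rightarrow> nat"
  assumes X: "finite X" and E: "clutter X E" and e: "e \<in> E" and J: "ideal J (mpoly_ring (jet_vars s X))"
    and coeffs: "\<And>j. j \<le> s \<Longrightarrow> coeff (jet_hom s (xpow (ind e))) j \<in> (J :: ('x \<times> nat, 'k::field) mpoly set)"
    and "sum f e \<le> s"
  shows "xpow (ind (graph f e)) \<in> radical (mpoly_ring (jet_vars s X)) J"
  using \<open>sum f e \<le> s\<close>
proof (induction "sum f e" arbitrary: f rule: less_induct)
  case less
  let ?R = "mpoly_ring (jet_vars s X) :: ('x \<times> nat, 'k) mpoly ring"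
  define rad where "rad = radical ?R J"
  define M where "M f = (xpow (ind (graph f e)) :: ('x \<times> nat, 'k) mpoly)" for f
  have rad: "ideal rad ?R" unfolding rad_def by (rule ideal_radical[OF J])
  have eX: "e \<subseteq> X" using E e by (auto simp: clutter_def)
  then have fin: "finite e" using X by (rule finite_subset)
  note supp_graph = supp_ind[OF finite_graph[OF fin]]
  \<comment> \<open>The coefficient formula ranges over extensional functions, so \<open>f\<close>
    is replaced by its restriction to \<open>e\<close>, which has the same graph and sum.\<close>
  define f' where "f' = restrict f e"
  have graph': "graph f' e = graph f e" by (auto simp: graph_def f'_def)
  have sum': "sum f' e = sum f e" by (simp add: f'_def)
  define G where "G = {g. g \<in> e \<rightarrow>\<^sub>E {..s} \<and> sum g e = sum f e}"
  have "f x \<le> s" if "x \<in> e" for x using member_le_sum[of x e f] that fin less.prems by simp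
  then have f': "f' \<in> G" by (auto simp: G_def sum') (auto simp: f'_def)
  have finG: "finite G" unfolding G_def
    by (rule finite_subset[of _ "e \<rightarrow>\<^sub>E {..s}"]) (use fin in \<open>auto intro: finite_PiE\<close>)
  have M_vars: "supp (ind (graph g e)) \<subseteq> jet_vars s X" if "sum g e \<le> s" for g
    using graph_subset_jet_vars[OF fin eX that] by (simp add: supp_graph)
  have carr: "M f' \<in> carrier ?R"
    using M_vars[of f'] less.prems by (simp add: M_def sum')
  have cross: "M f' * M g \<in> rad" if "g \<in> G - {f'}" for g
  proof -
    have g: "g \<in> e \<rightarrow>\<^sub>E {..s}" "sum g e = sum f' e" "g \<noteq> f'" using that by (auto simp: G_def sum')
    have "\<exists>x\<in>e. g x < f' x"
    proof (rule ccontr)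
      assume "\<not> (\<exists>x\<in>e. g x < f' x)"
      then have le: "f' x \<le> g x" if "x \<in> e" for x using that by (auto simp: not_less)
      have "f' x = g x" if "x \<in> e" for x
      proof (rule ccontr)
        assume "f' x \<noteq> g x"
        with le that have "sum f' e < sum g e"
          by (intro sum_strict_mono_ex1[OF fin]) (auto simp: order.strict_iff_order)
        with g(2) show False by simp
      qed
      then have "f' = g" using g(1) f' by (auto simp: G_def intro: PiE_ext)
      with g(3) show False by simp
    qed
    then obtain x where x: "x \<in> e" "g x < f' x" by blast
    \<comment> \<open>Lowering \<open>f'\<close> at \<open>x\<close> to the value of
      \<open>g\<close> lowers the sum, so the induction hypothesis applies to \<open>h\<close>. Its
      graph lies in the union of the graphs of \<open>f'\<close> and \<open>g\<close>, which gives
      the divisibility.\<close>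
    define h where "h = f'(x := g x)"
    have "sum h e < sum f e" unfolding sum'[symmetric]
      using x by (intro sum_strict_mono_ex1[OF fin]) (auto simp: h_def)
    then have "M h \<in> rad" using less.hyps[of h] less.prems by (simp add: rad_def M_def)
    moreover have "divides (ind (graph h e)) (ind (graph f' e) + ind (graph g e))"
      by (subst ind_divides_iff[OF finite_graph[OF fin]])
        (auto simp: supp_add supp_graph in_graph_iff h_def)
    moreover have "supp (ind (graph f' e) + ind (graph g e)) \<subseteq> jet_vars s X"
      using M_vars[of f'] M_vars[of g] g(2) less.prems by (simp add: supp_add sum')
    ultimately have "xpow (ind (graph f' e) + ind (graph g e)) \<in> rad"
      unfolding M_def by (rule mpoly_ideal_xpow[OF rad])
    then show ?thesis by (simp add: M_def mult_single)
  qed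
  have "sum M G \<in> J"
    using coeffs[OF less.prems] by (simp add: coeff_jet_hom[OF fin] G_def M_def)
  then have "sum M G \<in> rad"
    using mpoly_ideal_subset_radical[OF J] by (auto simp: rad_def)
  then have "M f' * sum M G \<in> rad" by (rule mpoly_ideal_mult[OF rad carr])
  moreover have "(\<Sum>g\<in>G - {f'}. M f' * M g) \<in> rad"
    by (rule mpoly_ideal_sum[OF rad cross])
  ultimately have "M f' * sum M G - (\<Sum>g\<in>G - {f'}. M f' * M g) \<in> rad"
    by (rule mpoly_ideal_diff[OF rad])
  moreover have "M f' * sum M G = M f' * M f' + (\<Sum>g\<in>G - {f'}. M f' * M g)"
    unfolding sum_distrib_left by (rule sum.remove[OF finG f'])
  ultimately have "M f' * M f' \<in> rad" by simp
  then obtain n where "(M f' * M f') ^ n \<in> J"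
    unfolding rad_def radical_mpoly by blast
  then have "M f' ^ (2 * n) \<in> J" by (simp add: power_mult power2_eq_square)
  with carr have "M f' \<in> rad" unfolding rad_def radical_mpoly by blast
  then show ?case by (simp add: rad_def M_def graph')
qed

text \<open>Every jet coefficient of degree at most \<open>s\<close> is a sum of monomials of
  \<open>jet_edges\<close>, whose ideal is radical because it is squarefree; this is one inclusion.
  The other is \<open>xpow_graph_in_radical_jet_ideal\<close> applied to each generator.\<close>

lemma radical_jet_ideal:
  assumes X: "finite X" and E: "clutter X E"
  shows "radical (mpoly_ring (jet_vars s X)) (jet_ideal s X (edge_monomials E))
           = (edge_ideal (jet_vars s X) (jet_edges s E) :: ('x \<times> nat, 'k::field) mpoly set)"
proof -
  let ?Y = "jet_vars s X"
  let ?R = "mpoly_ring ?Y :: ('x \<times> nat, 'k) mpoly ring"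
  interpret R: cring ?R by (rule cring_mpoly_ring)
  define F where "F = {coeff (jet_hom s p) j | (p :: ('x, 'k) mpoly) j. p \<in> edge_monomials E \<and> j \<le> s}"
  define K where "K = (edge_ideal ?Y (jet_edges s E) :: ('x \<times> nat, 'k) mpoly set)"
  have J: "jet_ideal s X (edge_monomials E) = Idl\<^bsub>?R\<^esub> F"
    by (simp add: jet_ideal_def F_def)
  have fin: "finite e" if "e \<in> E" for e
    using that E finite_subset[OF _ X] by (auto simp: clutter_def)
  have Y: "finite ?Y" and sub: "\<And>d. d \<in> jet_edges s E \<Longrightarrow> d \<subseteq> ?Y"
    using X finite_jet_vars jet_edges_subset[OF X E] by blast+
  have K: "K = monomial_ideal ?Y {m. \<exists>e\<in>jet_edges s E. e \<subseteq> supp m}"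
    unfolding K_def by (rule edge_ideal_eq_monomial_ideal[OF Y sub])
  have fin': "finite d" if "d \<in> jet_edges s E" for d using sub[OF that] Y by (rule finite_subset)
  have K': "K = monomial_ideal ?Y (multiples (ind ` jet_edges s E))"
    unfolding K by (simp add: multiples_ind fin')
  have idealK: "ideal K ?R" unfolding K by (rule ideal_monomial_ideal[OF up_closed_supp])
  have FK: "F \<subseteq> K"
  proof
    fix q assume "q \<in> F"
    then obtain e j where e: "e \<in> E" and j: "j \<le> s" and q: "q = coeff (jet_hom s (xpow (ind e))) j"
      by (auto simp: F_def edge_monomials_xpow)
    have "xpow (ind (graph f e)) \<in> K" if "sum f e = j" for f
    proof -
      have "graph f e \<in> jet_edges s E" using e j that by (auto simp: jet_edges_def)
      then show ?thesis unfolding K using sub fin' by (auto simp: supp_ind)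
    qed
    then show "q \<in> K" unfolding q coeff_jet_hom[OF fin[OF e]] by (intro mpoly_ideal_sum[OF idealK]) simp
  qed
  have carr: "F \<subseteq> carrier ?R" using FK mpoly_ideal_carrier[OF idealK] by blast
  have idealJ: "ideal (Idl\<^bsub>?R\<^esub> F) ?R" by (rule R.genideal_ideal[OF carr])
  have "radical ?R (Idl\<^bsub>?R\<^esub> F) \<subseteq> radical ?R K"
    using R.genideal_minimal[OF idealK FK] by (auto simp: radical_def)
  \<comment> \<open>Membership of a monomial in \<open>K\<close> depends on its support alone, and
    doubling an exponent keeps the support.\<close>
  also have "radical ?R K = K"
    unfolding K by (rule radical_monomial_ideal[OF up_closed_supp]) (simp add: supp_add)
  finally have "radical ?R (Idl\<^bsub>?R\<^esub> F) \<subseteq> K" .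
  moreover have "K \<subseteq> radical ?R (Idl\<^bsub>?R\<^esub> F)"
    unfolding K'
  proof (rule monomial_ideal_subset[OF ideal_radical[OF idealJ]])
    fix m assume "m \<in> ind ` jet_edges s E"
    then obtain f e where m: "m = ind (graph f e)" "e \<in> E" "sum f e \<le> s"
      by (auto simp: jet_edges_def)
    have "coeff (jet_hom s (xpow (ind e))) j \<in> Idl\<^bsub>?R\<^esub> F" if "j \<le> s" for j
    proof (rule subsetD[OF R.genideal_self[OF carr]])
      show "coeff (jet_hom s (xpow (ind e))) j \<in> F"
        using that m(2) by (auto simp: F_def edge_monomials_xpow)
    qed
    then show "xpow m \<in> radical ?R (Idl\<^bsub>?R\<^esub> F)"
      unfolding m(1) by (rule xpow_graph_in_radical_jet_ideal[OF X E m(2) idealJ _ m(3)])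
  qed
  ultimately show ?thesis unfolding J K_def by (rule equalityI)
qed

text \<open>\<open>radical_jet_ideal\<close> gives the defining property, and
  \<open>clutter_edge_ideal_subset\<close> in both directions gives uniqueness.\<close>

lemma jet_clutter_eq:
  assumes X: "finite X" and E: "clutter X E"
  shows "jet_clutter TYPE('k::field) s X E = jet_edges s E"
  unfolding jet_clutter_def
proof (rule the_equality)
  fix D assume D: "clutter (jet_vars s X) D \<and> edge_ideal (jet_vars s X) D =
    radical (mpoly_ring (jet_vars s X)) (jet_ideal s X (edge_monomials E :: ('a, 'k) mpoly set))"
  then have eq: "(edge_ideal (jet_vars s X) D :: ('a \<times> nat, 'k) mpoly set) =
      edge_ideal (jet_vars s X) (jet_edges s E)"
    by (simp add: radical_jet_ideal[OF X E])
  show "D = jet_edges s E"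
    using clutter_edge_ideal_subset[OF finite_jet_vars[OF X] _ clutter_jet_edges[OF X E] eq]
      clutter_edge_ideal_subset[OF finite_jet_vars[OF X] clutter_jet_edges[OF X E] _ eq[symmetric]] D
    by blast
qed (simp add: radical_jet_ideal[OF X E] clutter_jet_edges[OF X E])

section \<open>Ideals of covers and their symbolic powers\<close>

definition cover_exponents :: "'x set set \<Rightarrow> ('x \<Rightarrow>\<^sub>0 nat) set" where
  "cover_exponents D = {m. \<forall>e\<in>D. supp m \<inter> e \<noteq> {}}"

lemma up_closed_cover_exponents: "up_closed (cover_exponents D)"
  unfolding up_closed_def cover_exponents_def using divides_supp by blast

text \<open>Among the covers inside \<open>V\<close>, one of least cardinality is minimal for
  inclusion.\<close>

lemma vertex_cover_contains_minimal:
  assumes "finite X" "vertex_cover X D V"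
  obtains W where "minimal_vertex_cover X D W" "W \<subseteq> V"
proof -
  obtain W where W: "vertex_cover X D W" "W \<subseteq> V"
    and least: "\<And>W'. vertex_cover X D W' \<Longrightarrow> W' \<subseteq> V \<Longrightarrow> card W \<le> card W'"
    using ex_has_least_nat[of "\<lambda>W. vertex_cover X D W \<and> W \<subseteq> V" V card] assms(2) by auto
  have "finite W" using W(1) assms(1) by (auto simp: vertex_cover_def intro: finite_subset)
  have "\<not> vertex_cover X D W'" if "W' \<subset> W" for W'
    using psubset_card_mono[OF \<open>finite W\<close> that] least[of W'] that W(2) by auto
  with W that show thesis by (auto simp: minimal_vertex_cover_def)
qed

text \<open>A monomial in \<open>X\<close> is divisible by the product of a minimal cover exactly
  when its support is a cover, because every cover contains a minimal one.\<close>

lemma cover_ideal_eq_monomial_ideal: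
  assumes X: "finite X"
  shows "cover_ideal X D = (monomial_ideal X (cover_exponents D) :: ('x, 'k::field) mpoly set)"
proof -
  let ?C = "{W. minimal_vertex_cover X D W}"
  have sub: "W \<subseteq> X" if "W \<in> ?C" for W
    using that by (simp add: minimal_vertex_cover_def vertex_cover_def)
  have "cover_ideal X D = Idl\<^bsub>mpoly_ring X\<^esub> (xpow ` ind ` ?C :: ('x, 'k) mpoly set)"
    unfolding cover_ideal_def prod_mpoly_var by (rule arg_cong[where f = "genideal _"]) blast
  also have "\<dots> = monomial_ideal X {m. \<exists>W\<in>?C. W \<subseteq> supp m}"
    by (rule genideal_squarefree[OF X sub])
  also have "\<dots> = monomial_ideal X (cover_exponents D)"
    unfolding monomial_ideal_eq_iff
  proof (intro allI impI iffI)
    fix m :: "'x \<Rightarrow>\<^sub>0 nat" assume "m \<in> {m. \<exists>W\<in>?C. W \<subseteq> supp m}"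
    then show "m \<in> cover_exponents D"
      unfolding minimal_vertex_cover_def vertex_cover_def cover_exponents_def by blast
  next
    fix m :: "'x \<Rightarrow>\<^sub>0 nat" assume "supp m \<subseteq> X" "m \<in> cover_exponents D"
    then have "vertex_cover X D (supp m)"
      by (simp add: vertex_cover_def cover_exponents_def)
    then show "m \<in> {m. \<exists>W\<in>?C. W \<subseteq> supp m}"
      using vertex_cover_contains_minimal[OF X] by blast
  qed
  finally show ?thesis .
qed

section \<open>Powers of ideals generated by variables\<close>

lemma up_closed_sum_ge: "up_closed {m. k \<le> sum (coef m) e}"
  unfolding up_closed_def
proof (intro ballI allI impI)
  fix m n :: "'a \<Rightarrow>\<^sub>0 nat"
  assume m: "m \<in> {m. k \<le> sum (coef m) e}" and "divides m n"
  then have "sum (coef m) e \<le> sum (coef n) e" by (intro sum_mono) (simp add: divides_def)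
  with m show "n \<in> {m. k \<le> sum (coef m) e}" by simp
qed

lemma monomial_ideal_subset_xpow:
  fixes I :: "('x, 'k::comm_ring_1) mpoly set"
  assumes I: "ideal I (mpoly_ring X)" and "\<And>m. m \<in> U \<Longrightarrow> supp m \<subseteq> X \<Longrightarrow> xpow m \<in> I"
  shows "monomial_ideal X U \<subseteq> I"
proof -
  have "monomial_ideal X U \<subseteq> (monomial_ideal X (multiples {m \<in> U. supp m \<subseteq> X}) :: ('x, 'k) mpoly set)"
    by (auto simp: monomial_ideal_def intro!: multiples_self)
  also have "\<dots> \<subseteq> I" using assms(2) by (intro monomial_ideal_subset[OF I]) simp
  finally show ?thesis .
qed

lemma genideal_vars:
  assumes "finite e" "e \<subseteq> X"
  shows "Idl\<^bsub>mpoly_ring X\<^esub> (mpoly_var ` e) =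
           (monomial_ideal X {m. 1 \<le> sum (coef m) e} :: ('x, 'k::comm_ring_1) mpoly set)"
proof -
  let ?M = "(\<lambda>x. Poly_Mapping.single x (1::nat)) ` e"
  have "mpoly_var ` e = (xpow ` ?M :: ('x, 'k) mpoly set)"
    by (simp add: image_image mpoly_var_def)
  moreover have "supp m \<subseteq> X" if "m \<in> ?M" for m using that assms(2) by auto
  moreover have "divides (Poly_Mapping.single x 1) m \<longleftrightarrow> coef m x \<noteq> 0" for x and m :: "'x \<Rightarrow>\<^sub>0 nat"
    by (auto simp: divides_def lookup_single when_def)
  then have "multiples ?M = {m. 1 \<le> sum (coef m) e}"
    using assms(1) by (auto simp: multiples_def Suc_le_eq sum_nonneg_eq_0_iff not_le
        simp flip: neq0_conv)
  ultimately show ?thesis by (simp add: genideal_monomials)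
qed

text \<open>The exponent condition bounds the degree in the variables of \<open>e\<close> from
  below. Degrees add under multiplication; conversely, a monomial of degree at least
  \<open>k + 1\<close> splits off one variable of \<open>e\<close> and keeps degree at least
  \<open>k\<close>.\<close>

lemma genideal_vars_power:
  assumes e: "finite e" "e \<subseteq> X"
  shows "(Idl\<^bsub>mpoly_ring X\<^esub> (mpoly_var ` e)) [^]\<^bsub>ideals_set (mpoly_ring X)\<^esub> (k::nat) =
           (monomial_ideal X {m. k \<le> sum (coef m) e} :: ('x, 'k::comm_ring_1) mpoly set)"
proof (induction k)
  case 0
  \<comment> \<open>The zeroth power is the whole ring, and the degree bound is vacuous.\<close>
  show ?case by (simp add: ideals_set_def monomial_ideal_def)
next
  case (Suc k)
  let ?R = "mpoly_ring X :: ('x, 'k) mpoly ring"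
  interpret R: cring ?R by (rule cring_mpoly_ring)
  define I where "I k = (monomial_ideal X {m. k \<le> sum (coef m) e} :: ('x, 'k) mpoly set)" for k
  have I: "ideal (I k) ?R" for k
    unfolding I_def by (rule ideal_monomial_ideal[OF up_closed_sum_ge])
  have prod: "ideal (ideal_prod ?R (I k) (I 1)) ?R" by (rule R.ideal_prod_is_ideal[OF I I])
  have "ideal_prod ?R (I k) (I 1) \<subseteq> I (Suc k)"
  proof
    fix p assume "p \<in> ideal_prod ?R (I k) (I 1)"
    then show "p \<in> I (Suc k)"
    proof (induction p rule: ideal_prod.induct)
      case (prod p q)
      have "p * q \<in> I (Suc k)" unfolding I_def monomial_ideal_def
      proof (intro CollectI ballI)
        fix m assume "m \<in> supp (p * q)"
        then obtain a b where ab: "m = a + b" "a \<in> supp p" "b \<in> supp q"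
          using Poly_Mapping.keys_mult[of p q] by blast
        have "supp a \<subseteq> X" "k \<le> sum (coef a) e" "supp b \<subseteq> X" "1 \<le> sum (coef b) e"
          using ab prod by (auto simp: I_def monomial_ideal_def)
        then show "supp m \<subseteq> X \<and> m \<in> {m. Suc k \<le> sum (coef m) e}"
          by (simp add: ab(1) supp_add lookup_add sum.distrib)
      qed
      then show ?case by simp
    next
      case (sum p q)
      then show ?case using mpoly_ideal_add[OF I] by simp
    qed
  qed
  moreover have "I (Suc k) \<subseteq> ideal_prod ?R (I k) (I 1)"
    unfolding I_def[of "Suc k"]
  proof (rule monomial_ideal_subset_xpow[OF prod])
    fix m :: "'x \<Rightarrow>\<^sub>0 nat" assume m: "m \<in> {m. Suc k \<le> sum (coef m) e}" "supp m \<subseteq> X"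
    then have "sum (coef m) e \<noteq> 0" by simp
    then obtain x where x: "x \<in> e" "coef m x \<noteq> 0" by (rule sum.not_neutral_contains_not_neutral)
    define y where "y = Poly_Mapping.single x (1::nat)"
    have "divides y m" using x(2) by (auto simp: y_def divides_def lookup_single when_def)
    then have split: "m = y + (m - y)" by (rule divides_diff)
    have "sum (coef m) e = 1 + sum (coef (m - y)) e"
      using e(1) x(1) by (subst split) (simp add: y_def lookup_add sum.distrib lookup_single when_def)
    then have "xpow (m - y) \<in> I k"
      using m supp_diff[of m y] by (auto simp: I_def)
    moreover have "xpow y \<in> I 1"
      using e x(1) by (auto simp: I_def y_def lookup_single when_def)
    ultimately have "xpow (m - y) * xpow y \<in> ideal_prod ?R (I k) (I 1)"
      using ideal_prod.prod[of "xpow (m - y)" "I k" "xpow y" "I 1" ?R] by simp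
    then show "xpow m \<in> ideal_prod ?R (I k) (I 1)"
      using split by (simp add: mult_single add.commute)
  qed
  ultimately have "ideal_prod ?R (I k) (I 1) = I (Suc k)" by (rule equalityI)
  then show ?case
    using Suc.IH by (simp add: nat_pow_def ideals_set_def genideal_vars[OF e] I_def)
qed

definition symbolic_exponents :: "'x set set \<Rightarrow> nat \<Rightarrow> ('x \<Rightarrow>\<^sub>0 nat) set" where
  "symbolic_exponents E k = {m. \<forall>e\<in>E. k \<le> sum (coef m) e}"

lemma up_closed_symbolic_exponents: "up_closed (symbolic_exponents E k)"
  using up_closed_sum_ge unfolding up_closed_def symbolic_exponents_def by blast

lemma cover_ideal_symbolic_power_eq_monomial_ideal:
  assumes "finite X" "clutter X E"
  shows "cover_ideal_symbolic_power X E k =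
           (monomial_ideal X (symbolic_exponents E k) :: ('x, 'k::field) mpoly set)"
proof -
  have e: "finite e" "e \<subseteq> X" if "e \<in> E" for e
    using that assms finite_subset[of e X] by (auto simp: clutter_def)
  have "cover_ideal_symbolic_power X E k =
      carrier (mpoly_ring X) \<inter> (\<Inter>e\<in>E. (monomial_ideal X {m. k \<le> sum (coef m) e} :: ('x, 'k) mpoly set))"
    unfolding cover_ideal_symbolic_power_def by (simp add: genideal_vars_power e)
  \<comment> \<open>Without edges the intersection over \<open>E\<close> is the whole type; the
    carrier then keeps the variables inside \<open>X\<close>.\<close>
  also have "\<dots> = monomial_ideal X (symbolic_exponents E k)"
    by (auto simp: monomial_ideal_def symbolic_exponents_def)
  finally show ?thesis .
qed

section \<open>Depolarization of monomial ideals\<close>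

definition depolarize :: "('x \<times> nat \<Rightarrow>\<^sub>0 nat) \<Rightarrow> 'x \<Rightarrow>\<^sub>0 nat" where
  "depolarize m = (\<Sum>y\<in>supp m. Poly_Mapping.single (fst y) (coef m y))"

lemma mpoly_var_power: "mpoly_var x ^ n = xpow (Poly_Mapping.single x n)"
  by (induction n) (simp_all add: mpoly_var_def mult_single flip: single_add)

text \<open>Terms may merge or cancel under depolarization, so the sum runs over exponents of the
  source. The superset \<open>S\<close> serves polynomials whose support is known only up to
  inclusion.\<close>

lemma depolarization_eq_sum:
  fixes p :: "('x \<times> nat, 'k::field) mpoly"
  assumes "finite S" "supp p \<subseteq> S"
  shows "depolarization p = (\<Sum>m\<in>S. Poly_Mapping.single (depolarize m) (coef p m))"
proof -
  have "(\<Prod>y\<in>A. (case y of (x, i) \<Rightarrow> mpoly_var x) ^ c y) =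
      (xpow (\<Sum>y\<in>A. Poly_Mapping.single (fst y) (c y)) :: ('x, 'k) mpoly)"
    for A and c :: "'x \<times> nat \<Rightarrow> nat"
    by (induction A rule: infinite_finite_induct)
      (auto simp: split_beta mpoly_var_power mult_single)
  then have "depolarization p = (\<Sum>m\<in>supp p. Poly_Mapping.single (depolarize m) (coef p m))"
    by (simp add: depolarization_def mpoly_eval_def mpoly_const_def mult_single depolarize_def)
  also have "\<dots> = (\<Sum>m\<in>S. Poly_Mapping.single (depolarize m) (coef p m))"
    by (rule sum.mono_neutral_left[OF assms]) (simp add: in_keys_iff)
  finally show ?thesis .
qed

lemma depolarization_xpow: "depolarization (xpow m) = xpow (depolarize m)"
  by (subst depolarization_eq_sum[of "{m}"]) auto

text \<open>Every exponent in the image of a polynomial comes from one of its own exponents.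
  Conversely, \<open>q\<close> is lifted by choosing a preimage \<open>g n\<close> for each of its
  exponents \<open>n\<close> and keeping the coefficient.\<close>

lemma depolarization_image_monomial_ideal:
  assumes X: "\<And>m. m \<in> U \<Longrightarrow> supp m \<subseteq> Y \<Longrightarrow> supp (depolarize m) \<subseteq> X"
  shows "depolarization ` monomial_ideal Y U =
           (monomial_ideal X (depolarize ` {m \<in> U. supp m \<subseteq> Y}) :: ('x, 'k::field) mpoly set)"
proof (intro equalityI subsetI)
  fix q :: "('x, 'k) mpoly" assume "q \<in> depolarization ` monomial_ideal Y U"
  then obtain p :: "('x \<times> nat, 'k) mpoly" where p: "p \<in> monomial_ideal Y U" "q = depolarization p"
    by blast
  have "supp q \<subseteq> (\<Union>m\<in>supp p. supp (Poly_Mapping.single (depolarize m) (coef p m)))"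
    unfolding p(2) by (subst depolarization_eq_sum[OF finite_keys subset_refl]) (rule keys_sum)
  also have "\<dots> \<subseteq> depolarize ` supp p" by auto
  finally show "q \<in> monomial_ideal X (depolarize ` {m \<in> U. supp m \<subseteq> Y})"
    using p(1) X unfolding monomial_ideal_def by blast
next
  fix q :: "('x, 'k) mpoly" assume q: "q \<in> monomial_ideal X (depolarize ` {m \<in> U. supp m \<subseteq> Y})"
  then have "\<forall>n\<in>supp q. \<exists>m. m \<in> U \<and> supp m \<subseteq> Y \<and> depolarize m = n"
    by (fastforce simp: monomial_ideal_def)
  then obtain g where g: "\<And>n. n \<in> supp q \<Longrightarrow> g n \<in> U \<and> supp (g n) \<subseteq> Y \<and> depolarize (g n) = n"
    by metis
  \<comment> \<open>\<open>depolarize\<close> inverts \<open>g\<close> from the left, so the lifted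
    terms have distinct exponents and do not merge.\<close>
  have inj: "inj_on g (supp q)" using g by (metis inj_onI)
  define p where "p = (\<Sum>n\<in>supp q. Poly_Mapping.single (g n) (coef q n))"
  have "supp p \<subseteq> (\<Union>n\<in>supp q. supp (Poly_Mapping.single (g n) (coef q n)))"
    unfolding p_def by (rule keys_sum)
  then have supp_p: "supp p \<subseteq> g ` supp q" by (auto split: if_splits)
  then have "p \<in> monomial_ideal Y U" using g unfolding monomial_ideal_def by blast
  moreover have "coef p (g n) = coef q n" if n: "n \<in> supp q" for n
  proof -
    have "coef p (g n) = (\<Sum>n'\<in>supp q. if n' = n then coef q n' else 0)"
      unfolding p_def lookup_sum lookup_single when_def
      using inj_on_eq_iff[OF inj _ n] by (intro sum.cong) auto
    then show ?thesis using n by simp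
  qed
  then have "depolarization p = (\<Sum>n\<in>supp q. Poly_Mapping.single n (coef q n))"
    by (subst depolarization_eq_sum[OF _ supp_p]) (simp_all add: sum.reindex[OF inj] g)
  then have "depolarization p = q" by (simp flip: mpoly_sum_terms)
  ultimately show "q \<in> depolarization ` monomial_ideal Y U" by blast
qed

section \<open>Depolarization of covers\<close>

lemma coef_depolarize:
  assumes "supp m \<subseteq> jet_vars s X"
  shows "coef (depolarize m) x = (\<Sum>i\<le>s. coef m (x, i))"
proof -
  have "coef (depolarize m) x = (\<Sum>y\<in>supp m. if fst y = x then coef m y else 0)"
    by (simp add: depolarize_def lookup_sum lookup_single when_def)
  also have "\<dots> = (\<Sum>y\<in>Pair x ` {..s}. coef m y)"
  proof (rule sum.mono_neutral_cong)
    show "(if fst y = x then coef m y else 0) = 0" if "y \<in> supp m - Pair x ` {..s}" for y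
      using that assms by (cases y) (auto simp: jet_vars_def)
  qed (auto simp: in_keys_iff)
  also have "\<dots> = (\<Sum>i\<le>s. coef m (x, i))"
    by (subst sum.reindex) (auto simp: inj_on_def)
  finally show ?thesis .
qed

lemma supp_depolarize:
  assumes "supp m \<subseteq> jet_vars s X"
  shows "supp (depolarize m) \<subseteq> X"
proof
  fix x assume "x \<in> supp (depolarize m)"
  then have "(\<Sum>i\<le>s. coef m (x, i)) \<noteq> 0" by (simp add: in_keys_iff coef_depolarize[OF assms])
  then obtain i where "coef m (x, i) \<noteq> 0" by (rule sum.not_neutral_contains_not_neutral)
  then show "x \<in> X" using assms by (auto simp: in_keys_iff subset_iff mem_jet_vars_iff)
qed

lemma divides_depolarize:
  assumes "divides m n" "supp n \<subseteq> jet_vars s X"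
  shows "divides (depolarize m) (depolarize n)"
  unfolding divides_def
proof
  fix x
  have "supp m \<subseteq> jet_vars s X" using divides_supp[OF assms(1)] assms(2) by (rule order_trans)
  then show "coef (depolarize m) x \<le> coef (depolarize n) x"
    using assms by (auto simp: divides_def coef_depolarize intro!: sum_mono)
qed

text \<open>\<open>depolarize\<close> sums the exponents over the copies of each \<open>x\<close>; a
  pointwise inequality with equal finite sums is an equality.\<close>

lemma divides_depolarize_eq:
  assumes "divides m n" "supp n \<subseteq> jet_vars s X" "depolarize m = depolarize n"
  shows "m = n"
proof (rule poly_mapping_eqI)
  fix y :: "'a \<times> nat"
  obtain x i where y: "y = (x, i)" by (cases y)
  have m: "supp m \<subseteq> jet_vars s X" using divides_supp[OF assms(1)] assms(2) by (rule order_trans)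
  have le: "coef m y \<le> coef n y" for y using assms(1) unfolding divides_def by blast
  show "coef m y = coef n y"
  proof (cases "i \<le> s")
    case True
    have "(\<Sum>i\<le>s. coef m (x, i)) = (\<Sum>i\<le>s. coef n (x, i))"
      using arg_cong[OF assms(3), of "\<lambda>p. coef p x"]
      by (simp add: coef_depolarize[OF m] coef_depolarize[OF assms(2)])
    moreover have "(\<Sum>i\<le>s. coef m (x, i)) < (\<Sum>i\<le>s. coef n (x, i))" if "coef m y < coef n y"
      using that True le y by (intro sum_strict_mono_ex1) auto
    ultimately show ?thesis using le[of y] by (auto simp: order.order_iff_strict)
  next
    case False
    then have "y \<notin> jet_vars s X" by (simp add: y mem_jet_vars_iff)
    then have "y \<notin> supp n" using assms(2) by blast
    then show ?thesis using le[of y] by (simp add: in_keys_iff)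
  qed
qed

section \<open>Polarization as a section of depolarization\<close>

text \<open>
  The excess of \<open>m x\<close> over the \<open>s + 1\<close> available copies of \<open>x\<close> goes to \<open>x\<^sub>0\<close>; the subtraction is
  truncated.
\<close>

definition polarize :: "nat \<Rightarrow> ('x \<Rightarrow>\<^sub>0 nat) \<Rightarrow> ('x \<times> nat \<Rightarrow>\<^sub>0 nat)" where
  "polarize s m = Abs_poly_mapping (\<lambda>(x, i).
     (if i \<le> s \<and> i < coef m x then 1 else 0) + (if i = 0 then coef m x - (s + 1) else 0))"

lemma coef_polarize:
  "coef (polarize s m) (x, i) =
     (if i \<le> s \<and> i < coef m x then 1 else 0) + (if i = 0 then coef m x - (s + 1) else 0)"
proof -
  let ?f = "\<lambda>(x, i). (if i \<le> s \<and> i < coef m x then 1 else 0) + (if i = 0 then coef m x - (s + 1) else 0)"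
  have "{y. ?f y \<noteq> 0} \<subseteq> jet_vars s (supp m)"
    by (auto simp: mem_jet_vars_iff in_keys_iff split: if_splits)
  then have "finite {y. ?f y \<noteq> 0}" by (rule finite_subset) (intro finite_jet_vars finite_keys)
  then show ?thesis by (simp add: polarize_def)
qed

lemma supp_polarize: "(x, i) \<in> supp (polarize s m) \<longleftrightarrow> i \<le> s \<and> i < coef m x"
  by (auto simp: in_keys_iff coef_polarize)

lemma supp_polarize_subset: "supp m \<subseteq> X \<Longrightarrow> supp (polarize s m) \<subseteq> jet_vars s X"
  unfolding subset_iff split_paired_All supp_polarize mem_jet_vars_iff
  by (metis in_keys_iff not_less_zero)

lemma divides_polarize: "divides m n \<Longrightarrow> divides (polarize s m) (polarize s n)"
  unfolding divides_def
proof
  fix y :: "'a \<times> nat" assume "\<forall>x. coef m x \<le> coef n x"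
  then have "coef m (fst y) \<le> coef n (fst y)" by blast
  then show "coef (polarize s m) y \<le> coef (polarize s n) y"
    by (cases y) (auto simp: coef_polarize)
qed

text \<open>The first \<open>min (s + 1) (coef m x)\<close> copies contribute 1 each, and the
  truncated excess at index 0 supplies the rest, so exponents above \<open>s + 1\<close> are
  recovered too.\<close>

lemma depolarize_polarize: "depolarize (polarize s m) = m"
proof (rule poly_mapping_eqI)
  fix x
  have "(\<Sum>i\<le>s. if i \<le> s \<and> i < coef m x then 1 else 0) = card {i. i \<le> s \<and> i < coef m x}"
    by (simp flip: sum.inter_filter add: Collect_conj_eq)
  also have "{i. i \<le> s \<and> i < coef m x} = {..<min (s + 1) (coef m x)}" by auto
  finally show "coef (depolarize (polarize s m)) x = coef m x"
    by (simp add: coef_depolarize[OF supp_polarize_subset[OF subset_refl]] coef_polarize sum.distrib)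
qed

text \<open>Since \<open>sum f e \<le> s\<close> is below the sum of \<open>m\<close> over
  \<open>e\<close>, some \<open>x\<close> has \<open>f x < coef m x\<close>, so
  \<open>(x, f x)\<close> lies in the initial segment supporting \<open>polarize s m\<close>. That
  segment stops at index \<open>s\<close>, hence the separate bound on \<open>f x\<close>.\<close>

lemma polarize_mem_cover_exponents:
  assumes "m \<in> symbolic_exponents E (s + 1)" "\<And>e. e \<in> E \<Longrightarrow> finite e"
  shows "polarize s m \<in> cover_exponents (jet_edges s E)"
  unfolding cover_exponents_def
proof (intro CollectI ballI)
  fix d assume "d \<in> jet_edges s E"
  then obtain f e where d: "d = graph f e" "e \<in> E" "sum f e \<le> s"
    by (auto simp: jet_edges_def)
  have "sum f e < sum (coef m) e" using assms(1) d(2,3) by (auto simp: symbolic_exponents_def)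
  then obtain x where x: "x \<in> e" "f x < coef m x"
    by (meson not_le sum_mono)
  have "f x \<le> s" using member_le_sum[OF x(1), of f] assms(2)[OF d(2)] d(3) by simp
  with x have "(x, f x) \<in> supp (polarize s m) \<inter> d"
    by (simp add: supp_polarize d(1) in_graph_iff)
  then show "supp (polarize s m) \<inter> d \<noteq> {}" by blast
qed

text \<open>
  If \<open>a x\<close> is the least index of a copy of \<open>x\<close> missing from the cover, then no edge \<open>graph a e\<close> is
  covered, so the sum of \<open>a\<close> over \<open>e\<close> exceeds \<open>s\<close>.
\<close>

lemma polarize_divides_cover:
  assumes X: "finite X" and E: "clutter X E" and m: "m \<in> cover_exponents (jet_edges s E)"
  obtains n where "supp n \<subseteq> X" "n \<in> symbolic_exponents E (s + 1)" "divides (polarize s n) m"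
proof -
  \<comment> \<open>The disjunct \<open>s < i\<close> makes the least index exist and bounds it by
    \<open>s + 1\<close>; the value \<open>s + 1\<close> means that every copy of \<open>x\<close>
    occurs.\<close>
  define a where "a x = (LEAST i. s < i \<or> (x, i) \<notin> supp m)" for x
  have a_ex: "s < a x \<or> (x, a x) \<notin> supp m" for x
    unfolding a_def by (rule LeastI[of _ "s + 1"]) simp
  have a_less: "(x, i) \<in> supp m" if "i < a x" for x i
    using not_less_Least[of i "\<lambda>i. s < i \<or> (x, i) \<notin> supp m"] that by (auto simp: a_def)
  have a_le: "a x \<le> s + 1" for x
    unfolding a_def by (rule Least_le) simp
  define n where "n = Abs_poly_mapping (\<lambda>x. if x \<in> X then a x else 0)"
  have n: "coef n x = (if x \<in> X then a x else 0)" for x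
    unfolding n_def by (subst lookup_Abs_poly_mapping) (use X in \<open>auto intro: finite_subset\<close>)
  show thesis
  proof (rule that)
    show "supp n \<subseteq> X" by (auto simp: in_keys_iff n split: if_splits)
    show "n \<in> symbolic_exponents E (s + 1)" unfolding symbolic_exponents_def
    proof (intro CollectI ballI)
      fix e assume e: "e \<in> E"
      then have eX: "e \<subseteq> X" using E by (auto simp: clutter_def)
      then have "finite e" using X by (rule finite_subset)
      have "s < sum a e"
      proof (rule ccontr)
        assume "\<not> s < sum a e"
        then have "graph a e \<in> jet_edges s E" using e unfolding jet_edges_def not_less by blast
        then obtain x where x: "x \<in> e" "(x, a x) \<in> supp m"
          using m by (fastforce simp: cover_exponents_def graph_def)
        moreover have "a x \<le> sum a e" using member_le_sum[OF x(1), of a] \<open>finite e\<close> by simp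
        ultimately show False using a_ex[of x] \<open>\<not> s < sum a e\<close> by simp
      qed
      also have "sum a e = sum (coef n) e" using eX by (intro sum.cong) (auto simp: n)
      finally show "s + 1 \<le> sum (coef n) e" by simp
    qed
    show "divides (polarize s n) m" unfolding divides_def
    proof
      fix y :: "'a \<times> nat"
      obtain x i where y: "y = (x, i)" by (cases y)
      \<comment> \<open>As \<open>a x \<le> s + 1\<close> there is no excess at index 0, and every
        copy below \<open>a x\<close> already occurs in \<open>m\<close>.\<close>
      show "coef (polarize s n) y \<le> coef m y"
        using a_le[of x] a_less[of i x] by (auto simp: y coef_polarize n in_keys_iff)
    qed
  qed
qed

text \<open>A symbolic exponent is the image of its polarization, which is a cover exponent.
  Conversely, a cover exponent \<open>m\<close> is a multiple of some \<open>polarize s l\<close>,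
  so \<open>depolarize m\<close> is a multiple of \<open>l\<close>, and symbolic exponents are
  up-closed.\<close>

lemma depolarize_cover_exponents:
  assumes X: "finite X" and E: "clutter X E"
  shows "depolarize ` {m \<in> cover_exponents (jet_edges s E). supp m \<subseteq> jet_vars s X} =
           {n \<in> symbolic_exponents E (s + 1). supp n \<subseteq> X}"
proof (intro equalityI subsetI)
  have fin: "finite e" if "e \<in> E" for e using that E finite_subset[OF _ X] by (auto simp: clutter_def)
  fix n assume "n \<in> {n \<in> symbolic_exponents E (s + 1). supp n \<subseteq> X}"
  then have "polarize s n \<in> {m \<in> cover_exponents (jet_edges s E). supp m \<subseteq> jet_vars s X}"
    using polarize_mem_cover_exponents[OF _ fin] supp_polarize_subset by blast
  then show "n \<in> depolarize ` {m \<in> cover_exponents (jet_edges s E). supp m \<subseteq> jet_vars s X}"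
    by (rule rev_image_eqI) (simp add: depolarize_polarize)
next
  fix n assume "n \<in> depolarize ` {m \<in> cover_exponents (jet_edges s E). supp m \<subseteq> jet_vars s X}"
  then obtain m where m: "m \<in> cover_exponents (jet_edges s E)" "supp m \<subseteq> jet_vars s X" "n = depolarize m"
    by blast
  obtain l where l: "l \<in> symbolic_exponents E (s + 1)" "divides (polarize s l) m"
    using polarize_divides_cover[OF X E m(1)] by blast
  have "divides l n"
    using divides_depolarize[OF l(2) m(2)] by (simp add: depolarize_polarize m(3))
  then show "n \<in> {n \<in> symbolic_exponents E (s + 1). supp n \<subseteq> X}"
    using up_closedD[OF up_closed_symbolic_exponents l(1)] supp_depolarize[OF m(2)] m(3) by blast
qed

text \<open>The inverse is \<open>polarize s\<close>: a minimal \<open>m\<close> is divisible by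
  some \<open>polarize s n\<close>, itself a cover exponent, hence equals it. Monotonicity of both
  maps transfers minimality.\<close>

lemma bij_betw_depolarize_minimal_exponents:
  assumes X: "finite X" and E: "clutter X E"
  shows "bij_betw depolarize
           {m \<in> minimal_exponents (cover_exponents (jet_edges s E)). supp m \<subseteq> jet_vars s X}
           {n \<in> minimal_exponents (symbolic_exponents E (s + 1)). supp n \<subseteq> X}"
    (is "bij_betw _ ?A ?B")
proof (rule bij_betw_byWitness[where f' = "polarize s"])
  have fin: "finite e" if "e \<in> E" for e using that E finite_subset[OF _ X] by (auto simp: clutter_def)
  note pol = polarize_mem_cover_exponents[OF _ fin]
  have dep: "depolarize m \<in> symbolic_exponents E (s + 1)"
    if "m \<in> cover_exponents (jet_edges s E)" "supp m \<subseteq> jet_vars s X" for m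
    using depolarize_cover_exponents[OF X E, of s] that by blast
  have inv: "polarize s (depolarize m) = m" if m: "m \<in> ?A" for m
  proof -
    have "m \<in> cover_exponents (jet_edges s E)" using m by (simp add: minimal_exponents_def)
    then obtain n where n: "n \<in> symbolic_exponents E (s + 1)" "divides (polarize s n) m"
      using polarize_divides_cover[OF X E] by blast
    then have "polarize s n = m" using m pol[OF n(1)] by (auto simp: minimal_exponents_def)
    then show ?thesis using depolarize_polarize[of s n] by simp
  qed
  then show "\<forall>m\<in>?A. polarize s (depolarize m) = m" by blast
  show "\<forall>n\<in>?B. depolarize (polarize s n) = n" by (simp add: depolarize_polarize)
  show "depolarize ` ?A \<subseteq> ?B"
  proof (rule image_subsetI)
    fix m assume m: "m \<in> ?A"
    have "n = depolarize m" if n: "n \<in> symbolic_exponents E (s + 1)" "divides n (depolarize m)" for n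
    proof -
      have "divides (polarize s n) m" using divides_polarize[OF n(2), of s] by (simp add: inv[OF m])
      then have "polarize s n = m" using m pol[OF n(1)] by (auto simp: minimal_exponents_def)
      then show ?thesis using depolarize_polarize[of s n] by simp
    qed
    then show "depolarize m \<in> ?B"
      using m dep[of m] supp_depolarize[of m s X] by (auto simp: minimal_exponents_def)
  qed
  show "polarize s ` ?B \<subseteq> ?A"
  proof (rule image_subsetI)
    fix n assume n: "n \<in> ?B"
    then have Y: "supp (polarize s n) \<subseteq> jet_vars s X" by (simp add: supp_polarize_subset)
    \<comment> \<open>A divisor \<open>m\<close> depolarizes to a divisor of \<open>n\<close>, which
      is \<open>n\<close> by minimality; equal sums over the copies of each vertex then force
      equality.\<close>
    have "m = polarize s n"
      if m: "m \<in> cover_exponents (jet_edges s E)" "divides m (polarize s n)" for m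
    proof (rule divides_depolarize_eq[OF m(2) Y])
      have "supp m \<subseteq> jet_vars s X" using divides_supp[OF m(2)] Y by (rule order_trans)
      then have "depolarize m \<in> symbolic_exponents E (s + 1)" by (rule dep[OF m(1)])
      moreover have "divides (depolarize m) n"
        using divides_depolarize[OF m(2) Y] by (simp add: depolarize_polarize)
      ultimately show "depolarize m = depolarize (polarize s n)"
        using n by (simp add: minimal_exponents_def depolarize_polarize)
    qed
    then show "polarize s n \<in> ?A"
      using n pol[of n] Y by (auto simp: minimal_exponents_def)
  qed
qed

theorem theorem4p3:
  fixes X :: "'x set" and E :: "'x set set" and s :: nat
  assumes "finite X"
    and "clutter X E"
  shows "(depolarization :: ('x \<times> nat, 'k::field) mpoly \<Rightarrow> ('x, 'k) mpoly) `
             cover_ideal (jet_vars s X) (jet_clutter TYPE('k) s X E)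
           = cover_ideal_symbolic_power X E (s + 1) \<and>
         bij_betw (depolarization :: ('x \<times> nat, 'k) mpoly \<Rightarrow> ('x, 'k) mpoly)
           (minimal_monomial_generators (jet_vars s X)
              (cover_ideal (jet_vars s X) (jet_clutter TYPE('k) s X E)))
           (minimal_monomial_generators X (cover_ideal_symbolic_power X E (s + 1)))"
proof
  let ?C = "cover_exponents (jet_edges s E)" and ?S = "symbolic_exponents E (s + 1)"
  have C: "cover_ideal (jet_vars s X) (jet_clutter TYPE('k) s X E) =
      (monomial_ideal (jet_vars s X) ?C :: ('x \<times> nat, 'k) mpoly set)"
    by (simp add: jet_clutter_eq[OF assms] cover_ideal_eq_monomial_ideal[OF finite_jet_vars[OF assms(1)]])
  have S: "cover_ideal_symbolic_power X E (s + 1) = (monomial_ideal X ?S :: ('x, 'k) mpoly set)"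
    by (rule cover_ideal_symbolic_power_eq_monomial_ideal[OF assms])
  have "depolarization ` monomial_ideal (jet_vars s X) ?C =
      (monomial_ideal X {n \<in> ?S. supp n \<subseteq> X} :: ('x, 'k) mpoly set)"
    unfolding depolarize_cover_exponents[OF assms, symmetric]
    by (rule depolarization_image_monomial_ideal[OF supp_depolarize])
  \<comment> \<open>The restriction to \<open>X\<close> is already built into
    \<open>monomial_ideal\<close>.\<close>
  also have "\<dots> = monomial_ideal X ?S" by (simp add: monomial_ideal_eq_iff)
  finally show "(depolarization :: ('x \<times> nat, 'k) mpoly \<Rightarrow> ('x, 'k) mpoly) `
      cover_ideal (jet_vars s X) (jet_clutter TYPE('k) s X E) = cover_ideal_symbolic_power X E (s + 1)"
    unfolding C S .
  let ?A = "{m \<in> minimal_exponents ?C. supp m \<subseteq> jet_vars s X}"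
  let ?B = "{n \<in> minimal_exponents ?S. supp n \<subseteq> X}"
  have xpow: "bij_betw xpow M (xpow ` M :: ('y, 'k) mpoly set)" for M :: "('y \<Rightarrow>\<^sub>0 nat) set"
    by (rule inj_on_imp_bij_betw) (simp add: inj_on_def xpow_eq_iff)
  \<comment> \<open>The bijection of exponents passes to monomials: \<open>depolarization\<close>
    commutes with \<open>xpow\<close>, and the bijection \<open>xpow\<close> on the source is
    cancelled.\<close>
  have "bij_betw (xpow \<circ> depolarize) ?A (xpow ` ?B :: ('x, 'k) mpoly set)"
    by (rule bij_betw_trans[OF bij_betw_depolarize_minimal_exponents[OF assms] xpow])
  then have "bij_betw (depolarization \<circ> xpow) ?A (xpow ` ?B :: ('x, 'k) mpoly set)"
    by (simp add: comp_def depolarization_xpow)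
  then have "bij_betw depolarization (xpow ` ?A) (xpow ` ?B :: ('x, 'k) mpoly set)"
    by (simp add: bij_betw_comp_iff[OF xpow])
  then show "bij_betw (depolarization :: ('x \<times> nat, 'k) mpoly \<Rightarrow> ('x, 'k) mpoly)
      (minimal_monomial_generators (jet_vars s X)
         (cover_ideal (jet_vars s X) (jet_clutter TYPE('k) s X E)))
      (minimal_monomial_generators X (cover_ideal_symbolic_power X E (s + 1)))"
    unfolding C S minimal_monomial_generators_monomial_ideal[OF up_closed_cover_exponents]
      minimal_monomial_generators_monomial_ideal[OF up_closed_symbolic_exponents] .
qed

end
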